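(* Let $p\in(1,\infty)$ and let $\Omega$ be either $\mathbb R$ or a nondegenerate compact interval of $\mathbb R$. Assume $H$ satisfies Hypothesis A (see context) and that there exist continuous functions $f_1,f_2:[0,\infty)\to\mathbb R$ with $f_1(1)=1$, $f_2(1)=0$ and $$H(\alpha x)\le f_1(\alpha)H(x)+f_2(\alpha)x\qquad\text{for all }x,\alpha\in[0,\infty).$$ Then $(E_N)_{N\ge2}$ $\Gamma$-converges to $E$ with respect to the $W_p$-distance, i.e. for every $\rho\in\mathcal P_p(\Omega)$: (i) every sequence $(\mu_N)_{N\ge2}$ with $\mu_N\in\mathcal A_N(\Omega)$ and $W_p(\mu_N,\rho)\to0$ as $N\to\infty$ satisfies $E(\rho)\le\liminf_{N\to\infty}E_N(\mu_N)$; (ii) there exists a sequence $(\mu_N)_{N\ge2}$ with $\mu_N\in\mathcal A_N(\Omega)$, $W_p(\mu_N,\rho)\to0$ as $N\to\infty$ and $\limsup_{N\to\infty}E_N(\mu_N)\le E(\rho)$.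
   Context: $\mathcal P_p(\Omega)$ is the set of Borel probability measures on $\Omega$ with finite $p$-th moment, equipped with the $p$-Wasserstein distance $W_p$; $\mathcal P_{ac,p}(\Omega)$ is the subset of measures with a Lebesgue density. Hypothesis A: $H:[0,\infty)\to[0,\infty)$ is convex, in $C^\infty((0,\infty))\cap C^0([0,\infty))$, has superlinear growth at infinity ($H(x)/x\to\infty$ as $x\to\infty$), $H(0)=0$; there is $A>0$ with $H(x+y)\le A(1+H(x)+H(y))$ for all $x,y\ge0$; and $h(x)=xH(x^{-1})$ is strictly convex and non-increasing on $(0,\infty)$. Continuum energy: $E(\mu)=\int_\Omega H(\rho(x))\,dx$ if $\mu=\rho\,dx\in\mathcal P_{ac,p}(\Omega)$, and $E(\mu)=+\infty$ for other $\mu\in\mathcal P_p(\Omega)$. $\mathcal A_N(\Omega)$ is the set of empirical measures $\mu=\frac1N\sum_{i=1}^N\delta_{x_i}$ with $x_i\in\Omega$, the particles $x_1,\dots,x_N$ always being assumed distinct and sorted increasingly. Discrete energy: $E_N(\mu_N)=\sum_{i=1}^N|B_i|\,H\big(\frac1{N|B_i|}\big)$, where $B_i$ is the open interval centred at $x_i$ of radius $\frac12\min_{j\ne i}|x_i-x_j|$ and $|B_i|$ is its length. *)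

theory Defs
  imports "HOL-Probability.Probability"
begin

text \<open>A Borel probability measure on a closed set \<open>\<Omega>\<close> of reals is represented as a
  Borel probability measure on the real line that is concentrated on \<open>\<Omega>\<close>.\<close>

definition P_p :: "real \<Rightarrow> real set \<Rightarrow> real measure set" where
  "P_p p \<Omega> = {\<mu>. sets \<mu> = sets borel \<and> prob_space \<mu> \<and> emeasure \<mu> (- \<Omega>) = 0 \<and>
      (\<integral>\<^sup>+x. ennreal (\<bar>x\<bar> powr p) \<partial>\<mu>) < \<infinity>}"

definition P_ac :: "real \<Rightarrow> real set \<Rightarrow> real measure set" where
  "P_ac p \<Omega> = {\<mu> \<in> P_p p \<Omega>. \<exists>f \<in> borel_measurable lborel. \<mu> = density lborel f}"

definition couplings :: "real measure \<Rightarrow> real measure \<Rightarrow> (real \<times> real) measure set" where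
  "couplings \<mu> \<nu> = {\<gamma>. sets \<gamma> = sets (borel \<Otimes>\<^sub>M borel) \<and>
      distr \<gamma> borel fst = \<mu> \<and> distr \<gamma> borel snd = \<nu>}"

definition transport_cost :: "real \<Rightarrow> real measure \<Rightarrow> real measure \<Rightarrow> ennreal" where
  "transport_cost p \<mu> \<nu> =
    (INF \<gamma> \<in> couplings \<mu> \<nu>. \<integral>\<^sup>+z. ennreal (\<bar>fst z - snd z\<bar> powr p) \<partial>\<gamma>)"

text \<open>The case distinction is needed because \<open>enn2real \<top> = 0\<close>; for measures with finite
  \<open>p\<close>-th moment the cost is finite.\<close>

definition wasserstein :: "real \<Rightarrow> real measure \<Rightarrow> real measure \<Rightarrow> ennreal" where
  "wasserstein p \<mu> \<nu> = (if transport_cost p \<mu> \<nu> = \<top> then \<top>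
     else ennreal (enn2real (transport_cost p \<mu> \<nu>) powr (1 / p)))"

definition strictly_convex_on :: "real set \<Rightarrow> (real \<Rightarrow> real) \<Rightarrow> bool" where
  "strictly_convex_on S f \<longleftrightarrow> convex S \<and>
    (\<forall>x\<in>S. \<forall>y\<in>S. \<forall>t. x \<noteq> y \<longrightarrow> 0 < t \<longrightarrow> t < 1 \<longrightarrow>
       f ((1 - t) * x + t * y) < (1 - t) * f x + t * f y)"

text \<open>For open \<open>S\<close> the iterates of \<open>deriv\<close> at a point of \<open>S\<close> only depend on
  the values of the function on \<open>S\<close>.\<close>

definition C_infinity_on :: "real set \<Rightarrow> (real \<Rightarrow> real) \<Rightarrow> bool" where
  "C_infinity_on S f \<longleftrightarrow> open S \<and> (\<forall>n. \<forall>x\<in>S. (deriv ^^ n) f field_differentiable at x)"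

text \<open>Functions on \<open>[0,\<infinity>)\<close> are total functions on the reals whose values at negative
  arguments are irrelevant.\<close>

definition hypothesis_A :: "(real \<Rightarrow> real) \<Rightarrow> bool" where
  "hypothesis_A H \<longleftrightarrow>
     (\<forall>x\<ge>0. 0 \<le> H x) \<and>
     convex_on {0..} H \<and>
     C_infinity_on {0<..} H \<and>
     continuous_on {0..} H \<and>
     filterlim (\<lambda>x. H x / x) at_top at_top \<and>
     H 0 = 0 \<and>
     (\<exists>A>0. \<forall>x\<ge>0. \<forall>y\<ge>0. H (x + y) \<le> A * (1 + H x + H y)) \<and>
     strictly_convex_on {0<..} (\<lambda>x. x * H (inverse x)) \<and>
     antimono_on {0<..} (\<lambda>x. x * H (inverse x))"

text \<open>\<open>RN_deriv lborel \<mu>\<close> is a Lebesgue density of \<open>\<mu>\<close> whenever one exists. It takes values in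
  \<open>ennreal\<close>, but is finite almost everywhere for finite \<open>\<mu>\<close>.\<close>

definition energy :: "real \<Rightarrow> real set \<Rightarrow> (real \<Rightarrow> real) \<Rightarrow> real measure \<Rightarrow> ennreal" where
  "energy p \<Omega> H \<mu> = (if \<mu> \<in> P_ac p \<Omega>
     then \<integral>\<^sup>+x\<in>\<Omega>. ennreal (H (enn2real (RN_deriv lborel \<mu> x))) \<partial>lborel
     else \<infinity>)"

lemma energy_density:
  assumes "\<rho> \<in> borel_measurable borel" "\<And>x. 0 \<le> \<rho> x"
    and \<mu>: "density lborel (\<lambda>x. ennreal (\<rho> x)) \<in> P_p p \<Omega>"
  shows "energy p \<Omega> H (density lborel (\<lambda>x. ennreal (\<rho> x))) = (\<integral>\<^sup>+x\<in>\<Omega>. ennreal (H (\<rho> x)) \<partial>lborel)"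
proof -
  let ?\<mu> = "density lborel (\<lambda>x. ennreal (\<rho> x))"
  have m: "(\<lambda>x. ennreal (\<rho> x)) \<in> borel_measurable lborel"
    using assms(1) by simp
  have "AE x in lborel. ennreal (\<rho> x) = RN_deriv lborel ?\<mu> x"
    by (rule sigma_finite_measure.RN_deriv_unique[OF sigma_finite_lborel m refl])
  then have "AE x in lborel. enn2real (RN_deriv lborel ?\<mu> x) = \<rho> x"
    by eventually_elim (metis assms(2) enn2real_ennreal)
  then have "(\<integral>\<^sup>+x\<in>\<Omega>. ennreal (H (enn2real (RN_deriv lborel ?\<mu> x))) \<partial>lborel) =
      (\<integral>\<^sup>+x\<in>\<Omega>. ennreal (H (\<rho> x)) \<partial>lborel)"
    by (intro nn_integral_cong_AE) auto
  moreover have "?\<mu> \<in> P_ac p \<Omega>"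
    unfolding P_ac_def using \<mu> m by blast
  ultimately show ?thesis
    by (simp add: energy_def)
qed

text \<open>Particles are given by strictly increasing lists, indexed from 0.\<close>

definition empirical :: "real list \<Rightarrow> real measure" where
  "empirical xs = distr (uniform_count_measure {..<length xs}) borel (\<lambda>i. xs ! i)"

lemma emeasure_empirical:
  assumes "A \<in> sets borel" "xs \<noteq> []"
  shows "emeasure (empirical xs) A =
    ennreal (1 / real (length xs) * (\<Sum>i<length xs. measure (return borel (xs ! i)) A))"
proof -
  let ?n = "length xs"
  have "emeasure (empirical xs) A =
      emeasure (uniform_count_measure {..<?n}) ((\<lambda>i. xs ! i) -` A \<inter> {..<?n})"
    unfolding empirical_def
    by (subst emeasure_distr)
      (use assms in \<open>auto simp: space_uniform_count_measure measurable_def sets_uniform_count_measure\<close>)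
  also have "\<dots> = ennreal (real (card ((\<lambda>i. xs ! i) -` A \<inter> {..<?n})) / ?n)"
    by (subst emeasure_uniform_count_measure) (use assms in \<open>auto simp: divide_ennreal\<close>)
  also have "real (card ((\<lambda>i. xs ! i) -` A \<inter> {..<?n})) = (\<Sum>i<?n. indicator A (xs ! i))"
    by (simp add: indicator_def sum.If_cases Int_commute vimage_def)
  also have "\<dots> = (\<Sum>i<?n. measure (return borel (xs ! i)) A)"
    using assms by (simp add: measure_return)
  finally show ?thesis
    by simp
qed

definition A_N :: "nat \<Rightarrow> real set \<Rightarrow> real measure set" where
  "A_N N \<Omega> = {empirical xs | xs. length xs = N \<and> sorted_wrt (<) xs \<and> set xs \<subseteq> \<Omega>}"

text \<open>An empirical measure determines its particles, so the discrete energy is a function of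
  the measure.\<close>

definition particles :: "nat \<Rightarrow> real measure \<Rightarrow> real list" where
  "particles N \<mu> = (THE xs. length xs = N \<and> sorted_wrt (<) xs \<and> empirical xs = \<mu>)"

lemma particles_empirical:
  assumes "length xs = N" "sorted_wrt (<) xs"
  shows "particles N (empirical xs) = xs"
  unfolding particles_def
proof (rule the_equality)
  have supp: "set ys = {x. emeasure (empirical ys) {x} \<noteq> 0}" if "ys \<noteq> []" for ys
  proof -
    have "emeasure (empirical ys) {x} \<noteq> 0 \<longleftrightarrow> x \<in> set ys" for x
    proof -
      have "emeasure (empirical ys) {x} \<noteq> 0 \<longleftrightarrow> 0 < (\<Sum>i<length ys. indicator {x} (ys ! i) :: real)"
        using that by (simp add: emeasure_empirical measure_return ennreal_eq_0_iff not_le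
            zero_less_divide_iff)
      also have "\<dots> \<longleftrightarrow> \<not> (\<forall>i<length ys. indicator {x} (ys ! i) = (0::real))"
        by (subst less_le) (auto simp: sum_nonneg sum_nonneg_eq_0_iff)
      also have "\<dots> \<longleftrightarrow> x \<in> set ys"
        by (auto simp: in_set_conv_nth indicator_def)
      finally show ?thesis .
    qed
    then show ?thesis by auto
  qed
  fix ys assume ys: "length ys = N \<and> sorted_wrt (<) ys \<and> empirical ys = empirical xs"
  show "ys = xs"
  proof (cases "xs = []")
    case True
    then show ?thesis using ys assms by auto
  next
    case False
    then have "ys \<noteq> []" using ys assms by auto
    then have "set ys = set xs"
      using supp[OF False] supp[of ys] ys by simp
    then show ?thesis
      using ys assms strict_sorted_equal by blast
  qed
qed (use assms in auto)

definition particle_interval :: "real list \<Rightarrow> nat \<Rightarrow> real set" where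
  "particle_interval xs i =
    ball (xs ! i) (1 / 2 * Min {\<bar>xs ! i - xs ! j\<bar> | j. j < length xs \<and> j \<noteq> i})"

definition discrete_energy :: "nat \<Rightarrow> (real \<Rightarrow> real) \<Rightarrow> real measure \<Rightarrow> real" where
  "discrete_energy N H \<mu> =
    (let B = particle_interval (particles N \<mu>) in
     \<Sum>i<N. measure lborel (B i) * H (1 / (real N * measure lborel (B i))))"

end

theory Submission
  imports Defs
begin

text \<open>
  The idea is to read the discrete energy as the energy of the density that equals
  \<open>1 / (N |B\<^sub>i|)\<close> on each interval \<open>B\<^sub>i\<close>, and to use only two consequences of convexity and
  \<open>H 0 = 0\<close>: Jensen's inequality, and the fact that \<open>b H (m / b)\<close> decreases in \<open>b\<close>, so that longer
  intervals are cheaper.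

  For the lower bound let \<open>U\<close> be open with finite Lebesgue measure. By Jensen's inequality the
  intervals contained in \<open>U\<close> contribute at least \<open>|U| H (n / (N |U|))\<close> to the discrete energy, where
  \<open>n\<close> is their number. The intervals are disjoint, so at most \<open>|U| / (2 d)\<close> of those centred at
  distance at least \<open>d\<close> from the complement of \<open>U\<close> can leave \<open>U\<close>; with \<open>d\<close> fixed this number is
  negligible against \<open>N\<close>. Wasserstein convergence therefore gives that \<open>n / N\<close> is asymptotically at
  least \<open>\<rho> U\<close> (\<open>eventually_intervals_inside_ge\<close>), and for disjoint open sets the sum of
  \<open>|U\<^sub>k| H (\<rho> U\<^sub>k / |U\<^sub>k|)\<close> is at most the lower limit of the energies (\<open>liminf_ge_open\<close>).
  If this limit is finite, superlinear growth forces \<open>\<rho>\<close> to be absolutely continuous. Disjoint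
  level sets of its density are exhausted by compact sets, which have disjoint open
  neighbourhoods, and this turns the bound for open sets into the bound by the integral
  (\<open>liminf_ge_levels\<close>, \<open>liminf_ge_energy\<close>).

  For the recovery sequence an interval \<open>[a, b]\<close> is cut into cells of equal length \<open>d\<close>. Each cell
  receives the mass that \<open>\<rho>\<close> gives to it, the two outer cells also the mass of the tails, and
  this mass is represented by equally spaced particles. In a cell with spacing \<open>s\<close> all
  but the first and the last particle have an interval of length at least \<open>s\<close>, and these two have
  one of length at least \<open>s / 2\<close>; hence the energies have the limit \<open>\<Sum>k. d H (m\<^sub>k / d)\<close> at most
  (\<open>discrete_energy_grid_le\<close>, \<open>eventually_discrete_energy_grid_le\<close>), and by Jensen's inequality
  this is at most the energy of \<open>\<rho>\<close> up to the contribution of the tails. The quantile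
  coupling moves mass by at most \<open>d\<close>, apart from the tails and a set whose measure vanishes as
  \<open>N\<close> grows (\<open>eventually_transport_cost_grid_le\<close>). Letting the grid become finer and, on the real
  line, longer, a diagonal sequence satisfies both requirements.
\<close>

section \<open>Convexity inequalities\<close>

locale internal_energy =
  fixes H :: "real \<Rightarrow> real"
  assumes nonneg: "0 \<le> x \<Longrightarrow> 0 \<le> H x"
    and convex: "convex_on {0..} H"
    and cont: "continuous_on {0..} H"
    and zero: "H 0 = 0"
    and superlinear: "filterlim (\<lambda>x. H x / x) at_top at_top"
begin

lemma scale_le:
  assumes "0 \<le> t" "t \<le> 1" "0 \<le> x"
  shows "H (t * x) \<le> t * H x"
  using convex_onD[OF convex assms(1,2), of 0 x] assms zero by simp

lemma mono:
  assumes "0 \<le> x" "x \<le> y"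
  shows "H x \<le> H y"
proof (cases "y = 0")
  case False
  with assms have y: "y > 0" by simp
  have "H (x / y * y) \<le> x / y * H y"
    by (rule scale_le) (use assms y in auto)
  also have "\<dots> \<le> 1 * H y"
    by (rule mult_right_mono) (use assms y nonneg in auto)
  finally show ?thesis using y by simp
qed (use assms in auto)

text \<open>For \<open>m = 1 / N\<close> this says that a particle with a longer interval has less energy. It is the
convexity inequality between \<open>0\<close> and \<open>m / b\<close>.\<close>

lemma perspective_antimono:
  assumes "0 < b" "b \<le> c" "0 \<le> m"
  shows "c * H (m / c) \<le> b * H (m / b)"
proof -
  have "H (b / c * (m / b)) \<le> b / c * H (m / b)"
    by (rule scale_le) (use assms in auto)
  then have "c * H (m / c) \<le> c * (b / c * H (m / b))"
    using assms by (intro mult_left_mono) auto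
  then show ?thesis using assms by simp
qed

text \<open>Jensen's inequality for a density that equals \<open>m / b i\<close> on disjoint sets of measure \<open>b i\<close> and
vanishes elsewhere in a set of measure \<open>L\<close>; the part where it vanishes is free because
\<open>H 0 = 0\<close>.\<close>

lemma perspective_sum_ge:
  assumes fin: "finite I" and b: "\<And>i. i \<in> I \<Longrightarrow> 0 < b i" and L: "sum b I \<le> L" and m: "0 \<le> m"
  shows "L * H (real (card I) * m / L) \<le> (\<Sum>i\<in>I. b i * H (m / b i))"
proof (cases "I = {}")
  case False
  define S where "S = sum b I"
  have S: "S > 0" unfolding S_def using fin False b by (intro sum_pos) auto
  have "H (\<Sum>i\<in>I. (b i / S) *\<^sub>R (m / b i)) \<le> (\<Sum>i\<in>I. (b i / S) * H (m / b i))"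
    by (rule convex_on_sum[OF fin False convex])
      (use S b m in \<open>auto simp: S_def sum_divide_distrib[symmetric] less_imp_le\<close>)
  also have "(\<Sum>i\<in>I. (b i / S) *\<^sub>R (m / b i)) = (\<Sum>i\<in>I. m / S)"
    by (rule sum.cong) (use b in \<open>auto simp: less_imp_neq[THEN not_sym]\<close>)
  also have "\<dots> = real (card I) * m / S" by simp
  also have "(\<Sum>i\<in>I. (b i / S) * H (m / b i)) = (\<Sum>i\<in>I. b i * H (m / b i)) / S"
    by (simp add: sum_divide_distrib)
  finally have "S * H (real (card I) * m / S) \<le> (\<Sum>i\<in>I. b i * H (m / b i))"
    using S by (simp add: field_simps)
  moreover have "L * H (real (card I) * m / L) \<le> S * H (real (card I) * m / S)"
    by (rule perspective_antimono) (use S L m in \<open>auto simp: S_def\<close>)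
  ultimately show ?thesis by simp
qed (simp add: zero)

lemma supporting_slope:
  assumes "0 < m"
  obtains c where "0 \<le> c" "\<And>y. 0 \<le> y \<Longrightarrow> H m + c * (y - m) \<le> H y"
proof -
  have int: "m \<in> interior {0..}" using assms by (simp add: interior_real_atLeast)
  obtain c where c: "\<And>y. 0 \<le> y \<Longrightarrow> H m + c * (y - m) \<le> H y"
    using convex_le_Inf_differential[OF convex int] by auto
  have "H m \<le> c * m" using c[of 0] zero by simp
  then have "0 \<le> c * m" using nonneg[of m] assms by linarith
  then have "0 \<le> c" using assms by (simp add: zero_le_mult_iff)
  with c show ?thesis using that by blast
qed

end

section \<open>Particle intervals\<close>

definition gap :: "real list \<Rightarrow> nat \<Rightarrow> real" where
  "gap xs i = Min {\<bar>xs ! i - xs ! j\<bar> | j. j < length xs \<and> j \<noteq> i}"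

lemma particle_interval_eq: "particle_interval xs i = ball (xs ! i) (gap xs i / 2)"
  by (simp add: particle_interval_def gap_def)

context
  fixes xs :: "real list"
  assumes len: "2 \<le> length xs" and sorted: "sorted_wrt (<) xs"
begin

lemma gap_set: "finite {\<bar>xs ! i - xs ! j\<bar> | j. j < length xs \<and> j \<noteq> i}"
    "{\<bar>xs ! i - xs ! j\<bar> | j. j < length xs \<and> j \<noteq> i} \<noteq> {}"
proof -
  show "finite {\<bar>xs ! i - xs ! j\<bar> | j. j < length xs \<and> j \<noteq> i}" by simp
  show "{\<bar>xs ! i - xs ! j\<bar> | j. j < length xs \<and> j \<noteq> i} \<noteq> {}"
    using len by (cases "i = 0") (auto intro: exI[of _ 1] exI[of _ 0])
qed

lemma gap_le: "j < length xs \<Longrightarrow> j \<noteq> i \<Longrightarrow> gap xs i \<le> \<bar>xs ! i - xs ! j\<bar>"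
  unfolding gap_def by (rule Min_le[OF gap_set(1)]) auto

lemma le_gap: "(\<And>j. j < length xs \<Longrightarrow> j \<noteq> i \<Longrightarrow> r \<le> \<bar>xs ! i - xs ! j\<bar>) \<Longrightarrow> r \<le> gap xs i"
  unfolding gap_def using Min_ge_iff[OF gap_set] by auto

lemma gap_pos:
  assumes "i < length xs" shows "0 < gap xs i"
proof -
  have "xs ! i \<noteq> xs ! j" if "j < length xs" "j \<noteq> i" for j
    using sorted assms that by (metis linorder_neqE_nat order_less_irrefl sorted_wrt_nth_less)
  then show ?thesis
    unfolding gap_def using Min_gr_iff[OF gap_set] by auto
qed

lemma measure_particle_interval:
  assumes "i < length xs" shows "measure lborel (particle_interval xs i) = gap xs i"
  using gap_pos[OF assms] by (simp add: particle_interval_eq ball_eq_greaterThanLessThan)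

lemma particle_interval_disjoint:
  assumes "i < length xs" "j < length xs" "i \<noteq> j"
  shows "particle_interval xs i \<inter> particle_interval xs j = {}"
proof -
  have "gap xs i \<le> \<bar>xs ! i - xs ! j\<bar>" "gap xs j \<le> \<bar>xs ! i - xs ! j\<bar>"
    using gap_le[of j i] gap_le[of i j] assms by (auto simp: abs_minus_commute)
  then have "ball (xs ! i) (gap xs i / 2) \<inter> ball (xs ! j) (gap xs j / 2) = {}"
    by (intro disjoint_ballI) (simp add: dist_real_def)
  then show ?thesis
    by (simp add: particle_interval_eq)
qed

lemma discrete_energy_eq:
  "discrete_energy (length xs) H (empirical xs) =
    (\<Sum>i<length xs. gap xs i * H (1 / (real (length xs) * gap xs i)))"
  unfolding discrete_energy_def Let_def particles_empirical[OF refl sorted]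
  by (intro sum.cong) (auto simp: measure_particle_interval)

lemma sum_measure_disjoint_le:
  assumes "I \<subseteq> {..<length xs}" "\<And>i. i \<in> I \<Longrightarrow> V i \<subseteq> particle_interval xs i \<inter> U"
    and "\<And>i. V i \<in> sets borel" "U \<in> fmeasurable lborel"
  shows "(\<Sum>i\<in>I. measure lborel (V i)) \<le> measure lborel U"
proof -
  have fin: "finite I" using assms(1) finite_subset by blast
  have fm: "V i \<in> fmeasurable lborel" if "i \<in> I" for i
    using assms that by (intro fmeasurableI2[OF assms(4)]) auto
  have "(\<Sum>i\<in>I. measure lborel (V i)) = measure lborel (\<Union>i\<in>I. V i)"
  proof (rule measure_UNION'[symmetric, OF fin fm])
    show "pairwise (\<lambda>i j. disjnt (V i) (V j)) I"
    proof (rule pairwiseI)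
      fix i j assume "i \<in> I" "j \<in> I" "i \<noteq> j"
      then show "disjnt (V i) (V j)"
        using assms(1,2) particle_interval_disjoint[of i j] unfolding disjnt_def by blast
    qed
  qed
  also have "\<dots> \<le> measure lborel U"
  proof (rule measure_mono_fmeasurable[OF _ _ assms(4)])
    show "(\<Union>i\<in>I. V i) \<subseteq> U" using assms(2) by blast
    show "(\<Union>i\<in>I. V i) \<in> sets lborel" using fin assms(3) by (auto intro!: sets.finite_UN)
  qed
  finally show ?thesis .
qed

end

section \<open>Energy and mass in an open set\<close>

definition intervals_inside :: "real list \<Rightarrow> real set \<Rightarrow> nat set" where
  "intervals_inside xs U = {i. i < length xs \<and> particle_interval xs i \<subseteq> U}"

text \<open>Particles whose intervals lie in different sets \<open>U k\<close> are different, so their contributions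
add up; for each \<open>k\<close> Jensen's inequality applies because the intervals in \<open>U k\<close> are disjoint.\<close>

lemma (in internal_energy) discrete_energy_ge:
  assumes len: "2 \<le> length xs" and sorted: "sorted_wrt (<) xs" and fin: "finite S"
    and U: "\<And>k. k \<in> S \<Longrightarrow> U k \<in> fmeasurable lborel"
    and disj: "disjoint_family_on U S"
  shows "(\<Sum>k\<in>S. measure lborel (U k) *
            H (real (card (intervals_inside xs (U k))) / real (length xs) / measure lborel (U k)))
         \<le> discrete_energy (length xs) H (empirical xs)"
proof -
  let ?N = "length xs"
  let ?e = "\<lambda>i. gap xs i * H (1 / real ?N / gap xs i)"
  have inner: "intervals_inside xs (U k) \<subseteq> {..<?N}" for k by (auto simp: intervals_inside_def)
  have e0: "0 \<le> ?e i" if "i < ?N" for i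
    using gap_pos[OF len sorted that] nonneg by simp
  have "(\<Sum>k\<in>S. measure lborel (U k) * H (real (card (intervals_inside xs (U k))) / real ?N / measure lborel (U k)))
        \<le> (\<Sum>k\<in>S. \<Sum>i\<in>intervals_inside xs (U k). ?e i)"
  proof (rule sum_mono)
    fix k assume k: "k \<in> S"
    have "(\<Sum>i\<in>intervals_inside xs (U k). gap xs i) = (\<Sum>i\<in>intervals_inside xs (U k). measure lborel (particle_interval xs i))"
      by (rule sum.cong) (auto simp: intervals_inside_def measure_particle_interval[OF len sorted])
    also have "\<dots> \<le> measure lborel (U k)"
      by (rule sum_measure_disjoint_le[OF len sorted inner _ _ U[OF k]])
        (auto simp: intervals_inside_def particle_interval_eq)
    finally have le: "sum (gap xs) (intervals_inside xs (U k)) \<le> measure lborel (U k)" .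
    have "measure lborel (U k) * H (real (card (intervals_inside xs (U k))) * (1 / real ?N) / measure lborel (U k))
      \<le> (\<Sum>i\<in>intervals_inside xs (U k). ?e i)"
      by (rule perspective_sum_ge[OF _ _ le])
        (auto simp: intervals_inside_def gap_pos[OF len sorted])
    then show "measure lborel (U k) * H (real (card (intervals_inside xs (U k))) / real ?N / measure lborel (U k))
      \<le> (\<Sum>i\<in>intervals_inside xs (U k). ?e i)" by simp
  qed
  also have "\<dots> = (\<Sum>i\<in>(\<Union>k\<in>S. intervals_inside xs (U k)). ?e i)"
  proof (rule sum.UNION_disjoint[symmetric, OF fin])
    show "\<forall>i\<in>S. \<forall>j\<in>S. i \<noteq> j \<longrightarrow> intervals_inside xs (U i) \<inter> intervals_inside xs (U j) = {}"
    proof (intro ballI impI)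
      fix k l assume kl: "k \<in> S" "l \<in> S" "k \<noteq> l"
      then have "U k \<inter> U l = {}" using disj by (auto simp: disjoint_family_on_def)
      moreover have "xs ! i \<in> particle_interval xs i" if "i < ?N" for i
        using gap_pos[OF len sorted that] by (simp add: particle_interval_eq)
      ultimately show "intervals_inside xs (U k) \<inter> intervals_inside xs (U l) = {}"
        unfolding intervals_inside_def by blast
    qed
  qed (auto simp: intervals_inside_def)
  also have "\<dots> \<le> (\<Sum>i<?N. ?e i)"
    by (rule sum_mono2) (use inner e0 in auto)
  also have "\<dots> = discrete_energy ?N H (empirical xs)"
    by (simp add: discrete_energy_eq[OF len sorted])
  finally show ?thesis .
qed

lemma closed_inner_parallel: "closed {x. ball x r \<subseteq> (U :: 'a :: metric_space set)}"
proof -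
  have "{x. ball x r \<subseteq> U} = (\<Inter>y\<in>-U. {x. r \<le> dist x y})"
    by (auto simp: subset_iff not_less[symmetric] simp del: not_less)
  moreover have "closed {x. r \<le> dist x y}" for y :: 'a
    by (intro closed_Collect_le continuous_intros)
  ultimately show ?thesis by (simp add: closed_INT)
qed

lemma measure_empirical:
  assumes "A \<in> sets borel" "xs \<noteq> []"
  shows "measure (empirical xs) A = real (card {i. i < length xs \<and> xs ! i \<in> A}) / real (length xs)"
proof -
  have "(\<Sum>i<length xs. measure (return borel (xs ! i)) A) = (\<Sum>i<length xs. indicator A (xs ! i))"
    using assms by (simp add: measure_return)
  also have "\<dots> = real (card {i. i < length xs \<and> xs ! i \<in> A})"
    by (simp add: indicator_def sum.If_cases Int_def)
  finally show ?thesis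
    using assms by (simp add: measure_def emeasure_empirical)
qed

text \<open>Let \<open>y\<close> be a point whose \<open>2 d\<close>-ball lies in \<open>U\<close>. Either the coupling moves \<open>y\<close> by at least \<open>d\<close>,
which by Markov's inequality happens with probability at most \<open>k / d powr p\<close>, or the particle
coupled to \<open>y\<close> has its \<open>d\<close>-ball in \<open>U\<close>. In the second case its interval lies in \<open>U\<close>
unless it has length more than \<open>2 d\<close>, and disjointness bounds the number of such particles.\<close>

lemma measure_inner_parallel_le:
  assumes len: "2 \<le> length xs" and sorted: "sorted_wrt (<) xs"
    and U: "U \<in> fmeasurable lborel" and \<rho>: "prob_space \<rho>" and d: "0 < d" and k: "0 \<le> k" and p: "0 \<le> p"
    and cost: "transport_cost p (empirical xs) \<rho> < ennreal k"
  shows "measure \<rho> {x. ball x (2 * d) \<subseteq> U} \<le> real (card (intervals_inside xs U)) / real (length xs)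
    + measure lborel U / (2 * d * real (length xs)) + k / d powr p"
proof -
  let ?N = "length xs"
  obtain \<gamma> where \<gamma>: "\<gamma> \<in> couplings (empirical xs) \<rho>"
    and c: "(\<integral>\<^sup>+z. ennreal (\<bar>fst z - snd z\<bar> powr p) \<partial>\<gamma>) < ennreal k"
    using cost unfolding transport_cost_def INF_less_iff by blast
  have sets[measurable_cong, simp]: "sets \<gamma> = sets (borel \<Otimes>\<^sub>M borel)"
    and fst: "distr \<gamma> borel fst = empirical xs" and snd: "distr \<gamma> borel snd = \<rho>"
    using \<gamma> by (auto simp: couplings_def)
  have space: "space \<gamma> = UNIV" using sets_eq_imp_space_eq[OF sets] by (simp add: space_pair_measure)
  interpret \<rho>: prob_space \<rho> by fact
  have "emeasure \<gamma> (space \<gamma>) = emeasure \<rho> (space \<rho>)"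
    unfolding snd[symmetric] by (subst emeasure_distr) (auto simp: space)
  then interpret prob_space \<gamma>
    using \<rho>.emeasure_space_1 by (intro prob_spaceI) simp
  let ?V = "{x. ball x (2 * d) \<subseteq> U}" and ?W = "{x. ball x d \<subseteq> U}"
  let ?F = "{z. d \<le> \<bar>fst z - snd z\<bar>}"
  have [measurable]: "?V \<in> sets borel" "?W \<in> sets borel"
    by (auto intro: borel_closed closed_inner_parallel)
  have [measurable]: "?F \<in> sets \<gamma>"
  proof -
    have "{z\<in>space \<gamma>. d \<le> \<bar>fst z - snd z\<bar>} \<in> sets \<gamma>" by measurable
    then show ?thesis by (simp add: space)
  qed
  have "measure \<rho> ?V = measure \<gamma> (snd -` ?V \<inter> space \<gamma>)"
    unfolding snd[symmetric] by (subst measure_distr) auto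
  also have "\<dots> \<le> measure \<gamma> ((fst -` ?W \<inter> space \<gamma>) \<union> ?F)"
  proof (rule finite_measure_mono)
    show "snd -` ?V \<inter> space \<gamma> \<subseteq> (fst -` ?W \<inter> space \<gamma>) \<union> ?F"
    proof
      fix z assume z: "z \<in> snd -` ?V \<inter> space \<gamma>"
      show "z \<in> (fst -` ?W \<inter> space \<gamma>) \<union> ?F"
      proof (cases "d \<le> \<bar>fst z - snd z\<bar>")
        case False
        then have "ball (fst z) d \<subseteq> ball (snd z) (2 * d)"
          by (auto simp: dist_real_def)
        then show ?thesis using z by auto
      qed auto
    qed
    show "(fst -` ?W \<inter> space \<gamma>) \<union> ?F \<in> sets \<gamma>" by measurable
  qed
  also have "\<dots> \<le> measure \<gamma> (fst -` ?W \<inter> space \<gamma>) + measure \<gamma> ?F"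
    by (rule measure_Un_le) measurable
  also have "measure \<gamma> (fst -` ?W \<inter> space \<gamma>) = measure (empirical xs) ?W"
    unfolding fst[symmetric] by (subst measure_distr) auto
  also have "measure (empirical xs) ?W = real (card {i. i < ?N \<and> xs ! i \<in> ?W}) / real ?N"
    by (rule measure_empirical) (use len in auto)
  also have "\<dots> \<le> (real (card (intervals_inside xs U)) + measure lborel U / (2 * d)) / real ?N"
  proof (rule divide_right_mono)
    let ?A = "{i. i < ?N \<and> xs ! i \<in> ?W}" and ?B = "{i. i < ?N \<and> xs ! i \<in> ?W \<and> 2 * d < gap xs i}"
    have "?A \<subseteq> intervals_inside xs U \<union> ?B"
    proof
      fix i assume i: "i \<in> ?A"
      show "i \<in> intervals_inside xs U \<union> ?B"
      proof (cases "2 * d < gap xs i")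
        case False
        then have "particle_interval xs i \<subseteq> ball (xs ! i) d"
          by (auto simp: particle_interval_eq)
        then show ?thesis using i by (auto simp: intervals_inside_def)
      qed (use i in auto)
    qed
    then have "card ?A \<le> card (intervals_inside xs U \<union> ?B)"
      by (rule card_mono[rotated]) (auto simp: intervals_inside_def)
    also have "\<dots> \<le> card (intervals_inside xs U) + card ?B" by (rule card_Un_le)
    finally have "real (card ?A) \<le> real (card (intervals_inside xs U)) + real (card ?B)" by linarith
    moreover have "real (card ?B) * (2 * d) = (\<Sum>i\<in>?B. measure lborel (ball (xs ! i) d))"
      using d by (simp add: ball_eq_greaterThanLessThan)
    moreover have "\<dots> \<le> measure lborel U"
      by (rule sum_measure_disjoint_le[OF len sorted _ _ _ U])
        (auto simp: particle_interval_eq)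
    ultimately have "real (card ?B) \<le> measure lborel U / (2 * d)"
      and "real (card ?A) \<le> real (card (intervals_inside xs U)) + real (card ?B)"
      using d by (simp_all add: pos_le_divide_eq)
    then show "real (card ?A) \<le> real (card (intervals_inside xs U)) + measure lborel U / (2 * d)"
      by linarith
  qed simp
  also have "measure \<gamma> ?F \<le> k / d powr p"
  proof -
    have "emeasure \<gamma> {z\<in>space \<gamma>. 1 \<le> ennreal (1 / d powr p) * ennreal (\<bar>fst z - snd z\<bar> powr p)}
      \<le> ennreal (1 / d powr p) * (\<integral>\<^sup>+z. ennreal (\<bar>fst z - snd z\<bar> powr p) * indicator (space \<gamma>) z \<partial>\<gamma>)"
      using nn_integral_Markov_inequality[where u = "\<lambda>z. ennreal (\<bar>fst z - snd z\<bar> powr p)" and M = \<gamma> and A = "space \<gamma>" and c = "ennreal (1 / d powr p)"]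
        sets.top[of \<gamma>] by simp
    also have "\<dots> \<le> ennreal (1 / d powr p) * ennreal k"
      using c by (intro mult_left_mono) (auto cong: nn_integral_cong)
    also have "\<dots> = ennreal (k / d powr p)"
      using k by (simp add: ennreal_mult[symmetric])
    finally have le: "emeasure \<gamma> {z\<in>space \<gamma>. 1 \<le> ennreal (1 / d powr p) * ennreal (\<bar>fst z - snd z\<bar> powr p)} \<le> ennreal (k / d powr p)" .
    have sets_G: "{z\<in>space \<gamma>. 1 \<le> ennreal (1 / d powr p) * ennreal (\<bar>fst z - snd z\<bar> powr p)} \<in> sets \<gamma>"
      by measurable
    have "1 \<le> ennreal (1 / d powr p) * ennreal (\<bar>fst z - snd z\<bar> powr p)" if "z \<in> ?F" for z
    proof -
      have "d powr p \<le> \<bar>fst z - snd z\<bar> powr p"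
        using that d p by (intro powr_mono2) auto
      then have "1 \<le> 1 / d powr p * \<bar>fst z - snd z\<bar> powr p" using d by simp
      then have "ennreal 1 \<le> ennreal (1 / d powr p * \<bar>fst z - snd z\<bar> powr p)" by (rule ennreal_leI)
      also have "ennreal (1 / d powr p * \<bar>fst z - snd z\<bar> powr p)
          = ennreal (1 / d powr p) * ennreal (\<bar>fst z - snd z\<bar> powr p)"
        by (rule ennreal_mult) auto
      finally show ?thesis by simp
    qed
    then have "?F \<subseteq> {z\<in>space \<gamma>. 1 \<le> ennreal (1 / d powr p) * ennreal (\<bar>fst z - snd z\<bar> powr p)}"
      by (auto simp: space)
    then have "emeasure \<gamma> ?F \<le> ennreal (k / d powr p)"
      by (rule order_trans[OF emeasure_mono le]) (rule sets_G)
    then show ?thesis using k by (simp add: emeasure_eq_measure)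
  qed
  finally show ?thesis by (simp add: add_divide_distrib mult.assoc)
qed

lemma eventually_intervals_inside_ge:
  assumes xs: "\<And>N. 2 \<le> N \<Longrightarrow> length (xs N) = N" "\<And>N. 2 \<le> N \<Longrightarrow> sorted_wrt (<) (xs N)"
    and cost: "(\<lambda>N. transport_cost p (empirical (xs N)) \<rho>) \<longlonglongrightarrow> 0" and p: "0 \<le> p"
    and \<rho>: "prob_space \<rho>" "sets \<rho> = sets borel"
    and U: "open U" "U \<in> fmeasurable lborel" and t: "0 \<le> t" "t < 1"
  shows "\<forall>\<^sub>F N in sequentially. t * measure \<rho> U \<le> real (card (intervals_inside (xs N) U)) / real N"
proof (cases "measure \<rho> U = 0")
  case False
  interpret prob_space \<rho> by fact
  \<comment> \<open>One third of the allowed loss is spent on each of: shrinking \<open>U\<close>, long intervals, and transport.\<close>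
  define e where "e = (1 - t) * measure \<rho> U / 3"
  have e: "e > 0" unfolding e_def using False t by (simp add: zero_less_measure_iff)
  define V where "V n = {x. ball x (2 * (1 / real (Suc n))) \<subseteq> U}" for n
  have "(\<Union>n. V n) = U"
  proof (intro equalityI subsetI)
    fix x assume "x \<in> U"
    then obtain r where r: "r > 0" "ball x r \<subseteq> U" using U(1) openE by blast
    obtain n where "1 / real (Suc n) < r / 2" using nat_approx_posE[of "r/2"] r by auto
    then have "ball x (2 * (1 / real (Suc n))) \<subseteq> ball x r" by (intro subset_ball) simp
    then show "x \<in> (\<Union>n. V n)" unfolding V_def using r by blast
  next
    fix x assume "x \<in> (\<Union>n. V n)"
    then obtain n where "ball x (2 * (1 / real (Suc n))) \<subseteq> U" unfolding V_def by blast
    moreover have "x \<in> ball x (2 * (1 / real (Suc n)))" by simp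
    ultimately show "x \<in> U" by blast
  qed
  moreover have "incseq V"
  proof (rule incseq_SucI)
    fix n
    have "ball x (2 * (1 / real (Suc (Suc n)))) \<subseteq> ball x (2 * (1 / real (Suc n)))" for x :: real
      by (intro subset_ball) (simp add: field_simps)
    then show "V n \<le> V (Suc n)" unfolding V_def by blast
  qed
  moreover have "range V \<subseteq> sets \<rho>"
    unfolding V_def \<rho>(2) by (auto intro: borel_closed closed_inner_parallel)
  ultimately have "(\<lambda>n. measure \<rho> (V n)) \<longlonglongrightarrow> measure \<rho> U"
    using finite_Lim_measure_incseq[of V] by simp
  then have "\<forall>\<^sub>F n in sequentially. measure \<rho> U - e < measure \<rho> (V n)"
    by (rule order_tendstoD) (use e in auto)
  then obtain n where n: "measure \<rho> U - e < measure \<rho> (V n)"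
    by (auto simp: eventually_sequentially)
  define d where "d = 1 / real (Suc n)"
  have d: "d > 0" by (simp add: d_def)
  define k where "k = e * d powr p"
  have k: "k > 0" using e d by (simp add: k_def)
  have "\<forall>\<^sub>F N in sequentially. transport_cost p (empirical (xs N)) \<rho> < ennreal k"
    by (rule order_tendstoD(2)[OF cost]) (use k in simp)
  moreover have "(\<lambda>N. measure lborel U / (2 * d * real N)) \<longlonglongrightarrow> 0"
    using lim_const_over_n[of "measure lborel U / (2 * d)"] by simp
  then have "\<forall>\<^sub>F N in sequentially. measure lborel U / (2 * d * real N) < e"
    by (rule order_tendstoD(2)) (use e in simp)
  ultimately show ?thesis
    using eventually_ge_at_top[of 2]
  proof eventually_elim
    case (elim N)
    have "measure \<rho> (V n) \<le> real (card (intervals_inside (xs N) U)) / real N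
        + measure lborel U / (2 * d * real N) + k / d powr p"
      using measure_inner_parallel_le[of "xs N" U \<rho> d k p] elim xs[of N] U(2) \<rho>(1) d k p
      by (simp add: V_def d_def)
    moreover have "k / d powr p = e" using d by (simp add: k_def)
    moreover have "t * measure \<rho> U = measure \<rho> U - 3 * e" by (simp add: e_def field_simps)
    ultimately show ?case using n elim by linarith
  qed
qed simp

section \<open>Densities and regularity of Lebesgue measure\<close>

lemma prob_density_real:
  assumes f: "f \<in> borel_measurable lborel" "density lborel f = \<rho>" and \<rho>: "prob_space \<rho>"
  obtains g :: "real \<Rightarrow> real" where "g \<in> borel_measurable borel" "\<And>x. 0 \<le> g x"
    "\<rho> = density lborel (\<lambda>x. ennreal (g x))"
proof
  interpret prob_space \<rho> by fact
  have "(\<integral>\<^sup>+x. f x \<partial>lborel) = 1"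
    using emeasure_space_1 f by (subst (asm) f(2)[symmetric], subst (asm) emeasure_density) auto
  then have "AE x in lborel. f x \<noteq> \<infinity>"
    using f(1) by (intro nn_integral_PInf_AE) auto
  then have ae: "AE x in lborel. f x = ennreal (enn2real (f x))"
    by eventually_elim (simp add: less_top)
  show "(\<lambda>x. enn2real (f x)) \<in> borel_measurable borel" using f(1) by simp
  show "\<rho> = density lborel (\<lambda>x. ennreal (enn2real (f x)))"
    unfolding f(2)[symmetric] using f(1) ae by (intro density_cong) auto
qed simp

text \<open>Every point is given to the compact set that is strictly nearest to it.\<close>

lemma compact_separation:
  fixes K W :: "'i \<Rightarrow> 'a :: metric_space set"
  assumes fin: "finite S" and K: "\<And>k. k \<in> S \<Longrightarrow> compact (K k)" "\<And>k. k \<in> S \<Longrightarrow> K k \<noteq> {}"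
    and W: "\<And>k. k \<in> S \<Longrightarrow> open (W k)" "\<And>k. k \<in> S \<Longrightarrow> K k \<subseteq> W k"
    and disj: "disjoint_family_on K S"
  obtains U where "\<And>k. k \<in> S \<Longrightarrow> open (U k)" "\<And>k. k \<in> S \<Longrightarrow> K k \<subseteq> U k"
    "\<And>k. k \<in> S \<Longrightarrow> U k \<subseteq> W k" "disjoint_family_on U S"
proof
  let ?U = "\<lambda>k. W k \<inter> (\<Inter>l\<in>S-{k}. {x. infdist x (K k) < infdist x (K l)})"
  show "open (?U k)" if "k \<in> S" for k
  proof (rule open_Int[OF W(1)[OF that]], rule open_INT)
    show "finite (S - {k})" using fin by simp
    show "\<forall>l\<in>S - {k}. open {x. infdist x (K k) < infdist x (K l)}"
      by (intro ballI open_Collect_less continuous_intros)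
  qed
  show "K k \<subseteq> ?U k" if k: "k \<in> S" for k
  proof
    fix x assume x: "x \<in> K k"
    have "0 < infdist x (K l)" if "l \<in> S - {k}" for l
    proof -
      have "x \<notin> K l" using disj k that x by (auto simp: disjoint_family_on_def)
      then show ?thesis
        using in_closed_iff_infdist_zero[of "K l" x] K[of l] that compact_imp_closed
          infdist_nonneg[of x "K l"] by fastforce
    qed
    then show "x \<in> ?U k" using x W(2)[OF k] by auto
  qed
  show "?U k \<subseteq> W k" for k by blast
  show "disjoint_family_on ?U S"
    unfolding disjoint_family_on_def
  proof (intro ballI impI)
    fix k l assume "k \<in> S" "l \<in> S" "k \<noteq> l"
    then have "?U k \<subseteq> {x. infdist x (K k) < infdist x (K l)}"
      "?U l \<subseteq> {x. infdist x (K l) < infdist x (K k)}" by blast+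
    then show "?U k \<inter> ?U l = {}" by fastforce
  qed
qed

text \<open>Inner regularity holds for finite measures; here it is used for Lebesgue measure restricted
to \<open>A\<close>.\<close>

lemma lborel_inner_compact:
  fixes A :: "'a::euclidean_space set"
  assumes A: "A \<in> fmeasurable lborel" and c: "c < measure lborel A"
  obtains K where "compact K" "K \<subseteq> A" "c < measure lborel K"
proof (cases "c < 0")
  case True
  then show ?thesis using that[of "{}"] by auto
next
  case False
  define M where "M = density lborel (indicator A :: 'a \<Rightarrow> ennreal)"
  have [measurable]: "A \<in> sets borel" using A by auto
  have M: "emeasure M B = emeasure lborel (A \<inter> B)" if "B \<in> sets borel" for B
    using that unfolding M_def by (subst emeasure_density) (auto simp: indicator_inter_arith[symmetric] )
  have MA: "emeasure M A = emeasure lborel A" by (simp add: M)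
  have "emeasure M (space M) \<noteq> \<infinity>"
    using A M[of UNIV] by (auto simp: M_def fmeasurable_def)
  then have "emeasure M A = (SUP K\<in>{K. K \<subseteq> A \<and> compact K}. emeasure M K)"
    by (rule inner_regular[rotated]) (auto simp: M_def)
  moreover have "ennreal c < emeasure M A"
    unfolding MA using c A False by (subst emeasure_eq_measure2[OF A]) (simp add: ennreal_lessI)
  ultimately obtain K where K: "K \<subseteq> A" "compact K" "ennreal c < emeasure M K"
    by (auto simp: less_SUP_iff)
  have "emeasure M K = emeasure lborel K"
    using K M[of K] by (simp add: Int_absorb1 borel_compact)
  also have "\<dots> = ennreal (measure lborel K)"
    using emeasure_compact_finite[OF K(2)] by (simp add: emeasure_eq_ennreal_measure)
  finally have "c < measure lborel K" using K False by (simp add: ennreal_less_iff)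
  with K that show ?thesis by blast
qed

section \<open>Lower bound\<close>

context internal_energy
begin

lemma borel_measurable_compose:
  assumes [measurable]: "f \<in> borel_measurable M" and f: "\<And>x. 0 \<le> f x"
  shows "(\<lambda>x. H (f x)) \<in> borel_measurable M"
proof -
  have "continuous_on UNIV (\<lambda>x. H (max 0 x))"
    by (rule continuous_on_compose2[OF cont]) (auto intro!: continuous_intros)
  then have [measurable]: "(\<lambda>x. H (max 0 x)) \<in> borel_measurable borel"
    by (rule borel_measurable_continuous_onI)
  have "(\<lambda>x. H (max 0 (f x))) \<in> borel_measurable M" by measurable
  then show ?thesis using f by (simp add: max_def)
qed

context
  fixes xs :: "nat \<Rightarrow> real list" and p :: real and \<rho> :: "real measure" and L :: ennreal
  assumes xs: "\<And>N. 2 \<le> N \<Longrightarrow> length (xs N) = N" "\<And>N. 2 \<le> N \<Longrightarrow> sorted_wrt (<) (xs N)"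
    and cost: "(\<lambda>N. transport_cost p (empirical (xs N)) \<rho>) \<longlonglongrightarrow> 0" and p: "0 \<le> p"
    and \<rho>: "prob_space \<rho>" "sets \<rho> = sets borel"
    and L_def: "L = liminf (\<lambda>N. ennreal (discrete_energy N H (empirical (xs N))))"
begin

lemma liminf_ge_open:
  assumes fin: "finite S" and U: "\<And>k. k \<in> S \<Longrightarrow> open (U k)" "\<And>k. k \<in> S \<Longrightarrow> U k \<in> fmeasurable lborel"
    and disj: "disjoint_family_on U S" and t: "0 \<le> t" "t < 1"
  shows "ennreal (\<Sum>k\<in>S. measure lborel (U k) * H (t * measure \<rho> (U k) / measure lborel (U k))) \<le> L"
proof -
  have "\<forall>\<^sub>F N in sequentially. \<forall>k\<in>S. t * measure \<rho> (U k) \<le> real (card (intervals_inside (xs N) (U k))) / real N"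
    by (intro eventually_ball_finite fin ballI eventually_intervals_inside_ge[OF xs cost p \<rho>] U t)
  then have "\<forall>\<^sub>F N in sequentially. ennreal (\<Sum>k\<in>S. measure lborel (U k) *
      H (t * measure \<rho> (U k) / measure lborel (U k))) \<le> ennreal (discrete_energy N H (empirical (xs N)))"
    using eventually_ge_at_top[of 2]
  proof eventually_elim
    case (elim N)
    have "(\<Sum>k\<in>S. measure lborel (U k) * H (t * measure \<rho> (U k) / measure lborel (U k)))
      \<le> (\<Sum>k\<in>S. measure lborel (U k) *
          H (real (card (intervals_inside (xs N) (U k))) / real N / measure lborel (U k)))"
      using elim t by (intro sum_mono mult_left_mono mono divide_right_mono) auto
    also have "\<dots> \<le> discrete_energy N H (empirical (xs N))"
      using discrete_energy_ge[of "xs N" S U] xs[of N] elim fin U disj by auto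
    finally show ?case by (rule ennreal_leI)
  qed
  then show ?thesis unfolding L_def by (rule Liminf_bounded)
qed

text \<open>If \<open>\<rho>\<close> charged a null set \<open>Z\<close> with mass \<open>z\<close>, \<open>\<rho>\<close> would have mean density at least
\<open>z / |U|\<close> in an open neighbourhood \<open>U\<close> of \<open>Z\<close> of small measure, and by superlinear growth the
energy of the particles in \<open>U\<close> would be arbitrarily large.\<close>

lemma absolutely_continuous_if_liminf_finite:
  assumes L: "L < \<infinity>"
  shows "absolutely_continuous lborel \<rho>"
  unfolding absolutely_continuous_def
proof
  fix Z :: "real set" assume Z: "Z \<in> null_sets lborel"
  then have Zs: "Z \<in> sets borel" by auto
  interpret prob_space \<rho> by fact
  obtain l where l: "L = ennreal l" "0 \<le> l" using L by (cases L) auto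
  define z where "z = measure \<rho> Z"
  have "z = 0"
  proof (rule ccontr)
    assume "z \<noteq> 0"
    then have z: "z > 0" by (simp add: z_def zero_less_measure_iff)
    \<comment> \<open>The slope is chosen so that half of the mass \<open>z\<close> at this slope costs more than \<open>l\<close>.\<close>
    have "\<forall>\<^sub>F x in at_top. 2 * (l + 1) / z \<le> H x / x"
      using superlinear by (simp add: filterlim_at_top)
    then obtain q0 where q0: "\<And>x. q0 \<le> x \<Longrightarrow> 2 * (l + 1) / z \<le> H x / x"
      by (auto simp: eventually_at_top_linorder)
    define q where "q = max 1 q0"
    have q: "q > 0" "q \<ge> q0" by (auto simp: q_def)
    define e where "e = z / (2 * q)"
    have e: "e > 0" using z q by (simp add: e_def)
    obtain U where U: "open U" "Z \<subseteq> U" "emeasure lborel (U - Z) < e"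
      using outer_regular_lborel[OF Zs e] .
    have [measurable]: "U \<in> sets borel" using U by auto
    have "emeasure lborel U < e"
      using U Z emeasure_Diff_null_set[OF Z, of U] by simp
    then have fm: "U \<in> fmeasurable lborel"
      by (intro fmeasurableI) (auto intro: order.strict_trans)
    have me: "measure lborel U < e"
      using \<open>emeasure lborel U < e\<close> e by (simp add: emeasure_eq_measure2[OF fm] ennreal_less_iff)
    have zU: "z \<le> measure \<rho> U"
      unfolding z_def using U(2) \<rho>(2) by (intro finite_measure_mono) auto
    have "U \<noteq> {}" using zU z by auto
    then have mU: "0 < measure lborel U"
      using open_not_negligible[OF U(1)] fm null_sets_completionI[of U lborel]
      by (auto simp: zero_less_measure_iff measure_eq_0_null_sets negligible_iff_null_sets
          emeasure_eq_measure2 intro: null_setsI)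
    define r where "r = 1 / 2 * measure \<rho> U / measure lborel U"
    have mr: "measure lborel U * r = measure \<rho> U / 2"
      unfolding r_def using mU by simp
    have "q \<le> r"
    proof -
      have "q * measure lborel U \<le> q * e" using me q by (intro mult_left_mono) auto
      also have "\<dots> = z / 2" using q by (simp add: e_def)
      also have "\<dots> \<le> measure \<rho> U / 2" using zU by simp
      finally show ?thesis unfolding r_def using mU by (simp add: pos_le_divide_eq)
    qed
    then have "2 * (l + 1) / z \<le> H r / r" using q0 q by simp
    then have "2 * (l + 1) / z * r \<le> H r"
      using \<open>q \<le> r\<close> q(1) by (simp add: pos_le_divide_eq)
    then have ge: "measure lborel U * (2 * (l + 1) / z * r) \<le> measure lborel U * H r"
      by (rule mult_left_mono) simp
    have "(l + 1) * 1 \<le> (l + 1) * (measure \<rho> U / z)"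
      using l zU z by (intro mult_left_mono) (auto simp: pos_le_divide_eq)
    also have "\<dots> = measure lborel U * (2 * (l + 1) / z * r)"
      unfolding mult.left_commute[of "measure lborel U"] mr using z by (simp add: field_simps)
    also note ge
    also have "measure lborel U * H r \<le> l"
      using liminf_ge_open[of "{()}" "\<lambda>_. U" "1/2"] U(1) fm l nonneg
      by (simp add: r_def disjoint_family_on_def)
    finally show False by simp
  qed
  then have "emeasure \<rho> Z = 0" unfolding z_def by (simp add: emeasure_eq_measure)
  then show "Z \<in> null_sets \<rho>" using Zs \<rho>(2) by auto
qed

text \<open>The level sets \<open>A k\<close> are replaced by compact subsets, and these by open neighbourhoods that are
disjoint. The factor \<open>t\<close> in front of the measure pays for the passage to compact subsets; the
two factors in the argument of \<open>H\<close> pay for the passage to neighbourhoods and for the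
approximation of the mass of an open set by particles.\<close>

lemma liminf_ge_levels:
  assumes g: "g \<in> borel_measurable borel" "\<rho> = density lborel g"
    and fin: "finite S" and A: "\<And>k. k \<in> S \<Longrightarrow> A k \<in> fmeasurable lborel"
    and disj: "disjoint_family_on A S" and h: "\<And>k. k \<in> S \<Longrightarrow> 0 \<le> h k"
    and le: "\<And>k x. k \<in> S \<Longrightarrow> x \<in> A k \<Longrightarrow> ennreal (h k) \<le> g x"
    and t: "0 < t" "t < 1"
  shows "ennreal (\<Sum>k\<in>S. t * measure lborel (A k) * H (t * t * h k)) \<le> L"
proof -
  interpret prob_space \<rho> by fact
  note [measurable] = g(1)
  define S' where "S' = {k\<in>S. 0 < measure lborel (A k)}"
  have fin': "finite S'" using fin by (simp add: S'_def)
  have "\<exists>K. compact K \<and> K \<subseteq> A k \<and> t * measure lborel (A k) < measure lborel K" if "k \<in> S'" for k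
  proof -
    have "t * measure lborel (A k) < measure lborel (A k)" using that t by (simp add: S'_def)
    moreover have "A k \<in> fmeasurable lborel" using A that by (simp add: S'_def)
    ultimately obtain K where "compact K" "K \<subseteq> A k" "t * measure lborel (A k) < measure lborel K"
      using lborel_inner_compact by blast
    then show ?thesis by blast
  qed
  then obtain K where K: "\<And>k. k \<in> S' \<Longrightarrow> compact (K k)" "\<And>k. k \<in> S' \<Longrightarrow> K k \<subseteq> A k"
    "\<And>k. k \<in> S' \<Longrightarrow> t * measure lborel (A k) < measure lborel (K k)" by metis
  have Kpos: "0 < measure lborel (K k)" if "k \<in> S'" for k
    using K(3)[OF that] t that by (auto simp: S'_def intro: less_trans[rotated])
  have Kfm: "K k \<in> fmeasurable lborel" if "k \<in> S'" for k
    using K(1)[OF that] by (rule fmeasurable_compact)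
  have "\<exists>W. open W \<and> K k \<subseteq> W \<and> W \<in> fmeasurable lborel \<and> t * measure lborel W \<le> measure lborel (K k)"
    if k: "k \<in> S'" for k
  proof -
    define e where "e = (1 / t - 1) * measure lborel (K k)"
    have e: "e > 0" using Kpos[OF k] t by (simp add: e_def)
    have Ks: "K k \<in> sets borel" using K(1)[OF k] by (rule borel_compact)
    obtain W where W: "open W" "K k \<subseteq> W" "emeasure lborel (W - K k) < e"
      using outer_regular_lborel[OF Ks e] .
    have d: "W - K k \<in> fmeasurable lborel"
      using W Ks by (intro fmeasurableI) (auto intro: order.strict_trans)
    have eq: "W = K k \<union> (W - K k)" using W by blast
    have fm: "W \<in> fmeasurable lborel"
      using fmeasurable.Un[OF Kfm[OF k] d] eq by simp
    have "measure lborel (W - K k) < e"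
      using W(3) e by (simp add: emeasure_eq_measure2[OF d] ennreal_less_iff)
    moreover have "measure lborel W \<le> measure lborel (K k) + measure lborel (W - K k)"
      by (subst eq, rule measure_Un_le) (use Ks W in auto)
    ultimately have "measure lborel W \<le> measure lborel (K k) / t"
      by (simp add: e_def field_simps)
    then show ?thesis using W fm t by (auto simp: field_simps)
  qed
  then obtain W where W: "\<And>k. k \<in> S' \<Longrightarrow> open (W k)" "\<And>k. k \<in> S' \<Longrightarrow> K k \<subseteq> W k"
    "\<And>k. k \<in> S' \<Longrightarrow> W k \<in> fmeasurable lborel"
    "\<And>k. k \<in> S' \<Longrightarrow> t * measure lborel (W k) \<le> measure lborel (K k)" by metis
  have disjK: "disjoint_family_on K S'"
    using disj K(2) by (fastforce simp: disjoint_family_on_def S'_def)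
  have ne: "K k \<noteq> {}" if "k \<in> S'" for k using Kpos[OF that] by auto
  obtain U where U: "\<And>k. k \<in> S' \<Longrightarrow> open (U k)" "\<And>k. k \<in> S' \<Longrightarrow> K k \<subseteq> U k"
    "\<And>k. k \<in> S' \<Longrightarrow> U k \<subseteq> W k" "disjoint_family_on U S'"
    using compact_separation[OF fin' K(1) ne W(1,2) disjK] by blast
  have Ufm: "U k \<in> fmeasurable lborel" if "k \<in> S'" for k
    using fmeasurableI2[OF W(3)[OF that] U(3)[OF that]] U(1)[OF that] by auto
  have "(\<Sum>k\<in>S. t * measure lborel (A k) * H (t * t * h k))
     = (\<Sum>k\<in>S'. t * measure lborel (A k) * H (t * t * h k))"
    by (rule sum.mono_neutral_right) (use fin in \<open>auto simp: S'_def zero_less_measure_iff\<close>)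
  also have "\<dots> \<le> (\<Sum>k\<in>S'. measure lborel (U k) * H (t * measure \<rho> (U k) / measure lborel (U k)))"
  proof (rule sum_mono)
    fix k assume k: "k \<in> S'"
    then have kS: "k \<in> S" by (simp add: S'_def)
    have UK: "measure lborel (K k) \<le> measure lborel (U k)"
      using U(2)[OF k] Kfm[OF k] Ufm[OF k] by (intro measure_mono_fmeasurable) auto
    have UW: "measure lborel (U k) \<le> measure lborel (W k)"
      using U(3)[OF k] W(3)[OF k] Ufm[OF k] by (intro measure_mono_fmeasurable) auto
    have "ennreal (h k * measure lborel (K k)) = (\<integral>\<^sup>+x. ennreal (h k) * indicator (K k) x \<partial>lborel)"
      using Kfm[OF k] h[OF kS]
      by (subst nn_integral_cmult_indicator) (auto simp: emeasure_eq_measure2 ennreal_mult)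
    also have "\<dots> \<le> (\<integral>\<^sup>+x. g x * indicator (K k) x \<partial>lborel)"
      using le[OF kS] K(2)[OF k] by (intro nn_integral_mono) (auto simp: indicator_def)
    also have "\<dots> = emeasure \<rho> (K k)"
      unfolding g(2) using Kfm[OF k] by (subst emeasure_density) auto
    also have "\<dots> \<le> emeasure \<rho> (U k)"
      using U(1,2)[OF k] \<rho>(2) by (intro emeasure_mono) auto
    finally have hK: "h k * measure lborel (K k) \<le> measure \<rho> (U k)"
      by (simp add: emeasure_eq_measure)
    have "t * t * h k * measure lborel (U k) \<le> t * (h k * (t * measure lborel (W k)))"
      using UW t h[OF kS] by (simp add: mult_left_mono mult_ac)
    also have "\<dots> \<le> t * (h k * measure lborel (K k))"
      using W(4)[OF k] t h[OF kS] by (intro mult_left_mono) auto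
    also have "\<dots> \<le> t * measure \<rho> (U k)" using hK t by simp
    finally have q: "t * t * h k \<le> t * measure \<rho> (U k) / measure lborel (U k)"
      using Kpos[OF k] UK by (simp add: pos_le_divide_eq)
    have "t * measure lborel (A k) * H (t * t * h k) \<le> measure lborel (U k) * H (t * t * h k)"
      using K(3)[OF k] UK h[OF kS] t nonneg by (intro mult_right_mono) auto
    also have "\<dots> \<le> measure lborel (U k) * H (t * measure \<rho> (U k) / measure lborel (U k))"
      using q h[OF kS] t by (intro mult_left_mono mono) auto
    finally show "t * measure lborel (A k) * H (t * t * h k)
      \<le> measure lborel (U k) * H (t * measure \<rho> (U k) / measure lborel (U k))" .
  qed
  finally have "ennreal (\<Sum>k\<in>S. t * measure lborel (A k) * H (t * t * h k))
     \<le> ennreal (\<Sum>k\<in>S'. measure lborel (U k) * H (t * measure \<rho> (U k) / measure lborel (U k)))"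
    by (rule ennreal_leI)
  also have "\<dots> \<le> L"
    using liminf_ge_open[OF fin' U(1) Ufm U(4)] t by simp
  finally show ?thesis .
qed

text \<open>The density is approximated by simple functions while \<open>t\<close> tends to \<open>1\<close>; Fatou's lemma performs
both limits at once.\<close>

lemma liminf_ge_energy:
  assumes g: "g \<in> borel_measurable borel" "\<And>x. 0 \<le> g x" "\<rho> = density lborel (\<lambda>x. ennreal (g x))"
  shows "(\<integral>\<^sup>+x. ennreal (H (g x)) \<partial>lborel) \<le> L"
proof -
  interpret prob_space \<rho> by fact
  note [measurable] = g(1)
  have gm: "(\<lambda>x. ennreal (g x)) \<in> borel_measurable lborel" by simp
  obtain s :: "nat \<Rightarrow> real \<Rightarrow> ennreal" where s: "\<And>i. simple_function lborel (s i)" "incseq s" "\<And>i x. s i x < top"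
    "\<And>x. (SUP i. s i x) = ennreal (g x)"
    by (rule borel_measurable_implies_simple_function_sequence'[OF gm]) (rule that)
  define t where "t n = 1 - inverse (real (Suc (Suc n)))" for n
  have t: "0 < t n" "t n < 1" for n by (simp_all add: t_def inverse_less_1_iff)
  have "t \<longlonglongrightarrow> 1 - 0"
    unfolding t_def by (intro tendsto_diff tendsto_const LIMSEQ_Suc[OF LIMSEQ_inverse_real_of_nat])
  then have tlim: "t \<longlonglongrightarrow> 1" by simp
  define u where "u n x = ennreal (t n * H (t n * t n * enn2real (s n x)))" for n x
  have su: "simple_function lborel (u n)" for n
    unfolding u_def by (rule simple_function_compose1[OF s(1)])
  have sm: "s n \<in> borel_measurable lborel" for n by (rule borel_measurable_simple_function[OF s(1)])
  have sg: "s n x \<le> ennreal (g x)" for n x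
    using SUP_upper[of n UNIV "\<lambda>i. s i x"] s(4) by auto
  have int_u: "integral\<^sup>N lborel (u n) \<le> L" for n
  proof -
    define S where "S = range (s n) - {0}"
    define A where "A y = s n -` {y}" for y
    have fin: "finite S" using simple_functionD(1)[OF s(1)[of n]] by (simp add: S_def)
    have As: "A y \<in> sets borel" for y
      using simple_functionD(2)[OF s(1)[of n], of "{y}"] by (simp add: A_def)
    have pos: "0 < enn2real y" "ennreal (enn2real y) = y" if "y \<in> S" for y
      using that s(3) by (auto simp: S_def enn2real_positive_iff zero_less_iff_neq_zero)
    have fm: "A y \<in> fmeasurable lborel" if y: "y \<in> S" for y
    proof (rule fmeasurableI)
      \<comment> \<open>A level set of positive height has finite measure because the density has integral \<open>1\<close>.\<close>
      have "y * emeasure lborel (A y) = (\<integral>\<^sup>+x. y * indicator (A y) x \<partial>lborel)"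
        using As by (simp add: nn_integral_cmult)
      also have "\<dots> \<le> (\<integral>\<^sup>+x. ennreal (g x) \<partial>lborel)"
        using sg by (intro nn_integral_mono) (auto simp: A_def indicator_def)
      also have "\<dots> = emeasure \<rho> (space \<rho>)"
        unfolding g(3) by (subst emeasure_density) auto
      also have "\<dots> = 1" by (rule emeasure_space_1)
      finally have "y * emeasure lborel (A y) < \<infinity>" by (rule order.strict_trans1) simp
      then show "emeasure lborel (A y) < \<infinity>"
        using y by (auto simp: S_def ennreal_mult_less_top)
    qed (use As in simp)
    have u_sum: "u n x = (\<Sum>y\<in>S. ennreal (t n * H (t n * t n * enn2real y)) * indicator (A y) x)" for x
    proof (cases "s n x = 0")
      case True
      then show ?thesis
        by (auto simp: u_def zero A_def S_def indicator_def intro!: sum.neutral[symmetric])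
    next
      case False
      then have "s n x \<in> S" by (auto simp: S_def)
      have "(\<Sum>y\<in>S. ennreal (t n * H (t n * t n * enn2real y)) * indicator (A y) x)
        = (\<Sum>y\<in>{s n x}. ennreal (t n * H (t n * t n * enn2real y)) * indicator (A y) x)"
        by (rule sum.mono_neutral_right[OF fin]) (use \<open>s n x \<in> S\<close> in \<open>auto simp: A_def indicator_def\<close>)
      then show ?thesis by (simp add: A_def u_def)
    qed
    have "integral\<^sup>N lborel (u n)
       = (\<integral>\<^sup>+x. (\<Sum>y\<in>S. ennreal (t n * H (t n * t n * enn2real y)) * indicator (A y) x) \<partial>lborel)"
      by (rule nn_integral_cong) (rule u_sum)
    also have "\<dots> = (\<Sum>y\<in>S. ennreal (t n * H (t n * t n * enn2real y)) * emeasure lborel (A y))"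
      using As by (subst nn_integral_sum) (auto simp: nn_integral_cmult)
    also have "\<dots> = (\<Sum>y\<in>S. ennreal (t n * measure lborel (A y) * H (t n * t n * enn2real y)))"
      using fm t[of n] nonneg
      by (intro sum.cong) (auto simp: emeasure_eq_measure2 ennreal_mult[symmetric] mult_ac)
    also have "\<dots> = ennreal (\<Sum>y\<in>S. t n * measure lborel (A y) * H (t n * t n * enn2real y))"
      using t[of n] nonneg by (intro sum_ennreal) auto
    also have "\<dots> \<le> L"
    proof (rule liminf_ge_levels[OF _ g(3) fin fm])
      show "disjoint_family_on A S" by (auto simp: disjoint_family_on_def A_def)
      fix y x assume "y \<in> S" "x \<in> A y"
      then show "ennreal (enn2real y) \<le> ennreal (g x)"
        using pos[of y] sg[of n x] by (auto simp: A_def)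
    qed (use t in auto)
    finally show ?thesis .
  qed
  have lim_u: "(\<lambda>n. u n x) \<longlonglongrightarrow> ennreal (H (g x))" for x
  proof -
    have "(\<lambda>n. s n x) \<longlonglongrightarrow> ennreal (g x)"
      unfolding s(4)[symmetric] using s(2) by (intro LIMSEQ_SUP) (auto simp: incseq_def le_fun_def)
    then have e: "(\<lambda>n. enn2real (s n x)) \<longlonglongrightarrow> g x"
      by (rule tendsto_enn2real) (rule g(2))
    have "(\<lambda>n. t n * t n * enn2real (s n x)) \<longlonglongrightarrow> 1 * 1 * g x"
      by (intro tendsto_mult tlim e)
    then have "(\<lambda>n. H (t n * t n * enn2real (s n x))) \<longlonglongrightarrow> H (g x)"
      using g(2) t by (intro continuous_on_tendsto_compose[OF cont]) (auto simp: less_imp_le)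
    then have "(\<lambda>n. t n * H (t n * t n * enn2real (s n x))) \<longlonglongrightarrow> 1 * H (g x)"
      by (intro tendsto_mult tlim)
    then show ?thesis unfolding u_def by simp
  qed
  have "(\<integral>\<^sup>+x. ennreal (H (g x)) \<partial>lborel) = (\<integral>\<^sup>+x. liminf (\<lambda>n. u n x) \<partial>lborel)"
    by (intro nn_integral_cong) (simp add: lim_imp_Liminf[OF _ lim_u])
  also have "\<dots> \<le> liminf (\<lambda>n. integral\<^sup>N lborel (u n))"
    by (rule nn_integral_liminf) (rule borel_measurable_simple_function[OF su])
  also have "\<dots> \<le> liminf (\<lambda>n::nat. L)"
    by (intro Liminf_mono always_eventually allI int_u)
  also have "\<dots> = L" by (simp add: Liminf_const)
  finally show ?thesis .
qed

lemma energy_le_liminf: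
  assumes P: "\<rho> \<in> P_p p \<Omega>" and \<Omega>: "\<Omega> \<in> sets borel"
  shows "energy p \<Omega> H \<rho> \<le> L"
proof (cases "L = \<infinity>")
  case False
  then have "L < \<infinity>" by (simp add: less_top)
  then have "absolutely_continuous lborel \<rho>" by (rule absolutely_continuous_if_liminf_finite)
  then obtain f where f: "f \<in> borel_measurable lborel" "density lborel f = \<rho>"
    using sigma_finite_measure.Radon_Nikodym[OF sigma_finite_lborel] \<rho>(2) by auto
  obtain g :: "real \<Rightarrow> real" where g: "g \<in> borel_measurable borel" "\<And>x. 0 \<le> g x"
    "\<rho> = density lborel (\<lambda>x. ennreal (g x))"
    by (rule prob_density_real[OF f \<rho>(1)]) (rule that)
  have "energy p \<Omega> H \<rho> = (\<integral>\<^sup>+x\<in>\<Omega>. ennreal (H (g x)) \<partial>lborel)"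
    using energy_density[OF g(1,2), of p \<Omega> H] P g(3) by simp
  also have "\<dots> \<le> (\<integral>\<^sup>+x. ennreal (H (g x)) \<partial>lborel)"
    by (intro nn_integral_mono) (auto simp: indicator_def)
  also have "\<dots> \<le> L" by (rule liminf_ge_energy[OF g])
  finally show ?thesis .
qed simp

end

end

section \<open>Equally spaced particles in the cells of a grid\<close>

text \<open>Cell \<open>k\<close> is the interval between \<open>a + d k\<close> and \<open>a + d (k + 1)\<close>. The nondecreasing function \<open>C\<close>
distributes the particles: those with index from \<open>C k\<close> up to \<open>C (k + 1) - 1\<close> belong to cell \<open>k\<close>,
which may be empty.\<close>

definition cell :: "(nat \<Rightarrow> nat) \<Rightarrow> nat \<Rightarrow> nat" where
  "cell C i = (LEAST k. i < C (Suc k))"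

definition spacing :: "real \<Rightarrow> (nat \<Rightarrow> nat) \<Rightarrow> nat \<Rightarrow> real" where
  "spacing d C k = d / real (C (Suc k) - C k)"

text \<open>The particles of a cell are the midpoints of its subdivision into equal parts, one for each
particle.\<close>

definition grid_particle :: "real \<Rightarrow> real \<Rightarrow> (nat \<Rightarrow> nat) \<Rightarrow> nat \<Rightarrow> real" where
  "grid_particle a d C i = a + d * real (cell C i)
     + spacing d C (cell C i) * (real i - real (C (cell C i)) + 1 / 2)"

context
  fixes a d :: real and C :: "nat \<Rightarrow> nat" and K :: nat
  assumes d: "0 < d" and C: "mono C" "C 0 = 0"
begin

lemma cell_eq:
  assumes "C k \<le> i" "i < C (Suc k)"
  shows "cell C i = k"
  unfolding cell_def
proof (rule Least_equality)
  fix l assume "i < C (Suc l)"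
  then show "k \<le> l"
    using monoD[OF C(1), of "Suc l" k] assms(1) by (rule_tac ccontr) auto
qed fact

lemma cell_bounds:
  assumes "i < C K"
  shows "cell C i < K" "C (cell C i) \<le> i" "i < C (Suc (cell C i))"
proof -
  obtain K' where K: "K = Suc K'" using assms C(2) by (cases K) auto
  show "i < C (Suc (cell C i))"
    unfolding cell_def by (rule LeastI[of _ K']) (use assms K in simp)
  have "cell C i \<le> K'" unfolding cell_def by (rule Least_le) (use assms K in simp)
  then show "cell C i < K" using K by simp
  show "C (cell C i) \<le> i"
  proof (cases "cell C i")
    case (Suc l)
    then have "\<not> i < C (Suc l)" using not_less_Least[of l "\<lambda>k. i < C (Suc k)"] by (simp add: cell_def)
    then show ?thesis using Suc by simp
  qed (simp add: C)
qed

lemma spacing_pos: "C k < C (Suc k) \<Longrightarrow> 0 < spacing d C k"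
  using d by (simp add: spacing_def)

lemma grid_particle_right:
  assumes "i < C K"
  shows "grid_particle a d C i = a + d * (real (cell C i) + 1)
    - spacing d C (cell C i) * (real (C (Suc (cell C i))) - real i - 1 / 2)"
proof -
  let ?k = "cell C i"
  have "C ?k < C (Suc ?k)" using cell_bounds[OF assms] by linarith
  then have "spacing d C ?k * (real (C (Suc ?k)) - real (C ?k)) = d"
    by (simp add: spacing_def of_nat_diff)
  then show ?thesis unfolding grid_particle_def by (simp add: algebra_simps)
qed

lemma grid_particle_bounds:
  assumes "i < C K"
  shows "a + d * real (cell C i) < grid_particle a d C i"
    "grid_particle a d C i < a + d * (real (cell C i) + 1)"
proof -
  let ?k = "cell C i"
  have b: "C ?k \<le> i" "i < C (Suc ?k)" using cell_bounds[OF assms] by auto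
  have s: "0 < spacing d C ?k" using b by (intro spacing_pos) auto
  have "0 < spacing d C ?k * (real i - real (C ?k) + 1 / 2)"
    "0 < spacing d C ?k * (real (C (Suc ?k)) - real i - 1 / 2)"
    using s b by (auto intro!: mult_pos_pos)
  then show "a + d * real ?k < grid_particle a d C i" "grid_particle a d C i < a + d * (real ?k + 1)"
    using grid_particle_right[OF assms] by (auto simp: grid_particle_def)
qed

lemma grid_particle_range:
  assumes "i < C K"
  shows "grid_particle a d C i \<in> {a..a + d * real K}"
proof -
  have "real (cell C i) + 1 \<le> real K" using cell_bounds[OF assms] by simp
  then have "d * (real (cell C i) + 1) \<le> d * real K" using d by (intro mult_left_mono) auto
  moreover have "0 \<le> d * real (cell C i)" using d by simp
  ultimately show ?thesis using grid_particle_bounds[OF assms] by auto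
qed

lemma grid_particle_diff_same:
  assumes "i < j" "j < C K" "cell C i = cell C j"
  shows "spacing d C (cell C j) \<le> grid_particle a d C j - grid_particle a d C i"
proof -
  have "0 < spacing d C (cell C j)"
    by (rule spacing_pos) (use cell_bounds[OF assms(2)] in linarith)
  then have "spacing d C (cell C j) * 1 \<le> spacing d C (cell C j) * (real j - real i)"
    using assms by (intro mult_left_mono) auto
  then show ?thesis using assms(3) by (simp add: grid_particle_def algebra_simps)
qed

text \<open>Both distances to the boundary of the own cell are kept: an interior particle of its cell
has one of at least \<open>3 / 2\<close> spacings, which is what \<open>grid_particle_separation\<close> needs.\<close>

lemma grid_particle_diff_cross:
  assumes "i < j" "j < C K" "cell C i \<noteq> cell C j"
  shows "spacing d C (cell C i) * (real (C (Suc (cell C i))) - real i - 1 / 2)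
    + spacing d C (cell C j) * (real j - real (C (cell C j)) + 1 / 2)
    \<le> grid_particle a d C j - grid_particle a d C i"
proof -
  have i: "i < C K" using assms by simp
  have "\<not> cell C j < cell C i"
  proof
    assume "cell C j < cell C i"
    then have "C (Suc (cell C j)) \<le> C (cell C i)" by (intro monoD[OF C(1)]) simp
    then show False using cell_bounds[OF i] cell_bounds[OF assms(2)] assms(1) by simp
  qed
  then have "real (cell C i) + 1 \<le> real (cell C j)" using assms(3) by simp
  then have "d * (real (cell C i) + 1) \<le> d * real (cell C j)" using d by (intro mult_left_mono) auto
  then show ?thesis
    unfolding grid_particle_right[OF i] by (simp add: grid_particle_def)
qed

lemma grid_particle_strict_mono:
  assumes "i < j" "j < C K"
  shows "grid_particle a d C i < grid_particle a d C j"
proof (cases "cell C i = cell C j")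
  case True
  have "0 < spacing d C (cell C j)"
    by (rule spacing_pos) (use cell_bounds[OF assms(2)] in linarith)
  then show ?thesis using grid_particle_diff_same[OF assms True] by simp
next
  case False
  have i: "i < C K" using assms by simp
  have "0 < spacing d C (cell C i) * (real (C (Suc (cell C i))) - real i - 1 / 2)"
    "0 < spacing d C (cell C j) * (real j - real (C (cell C j)) + 1 / 2)"
    using cell_bounds[OF i] cell_bounds[OF assms(2)] by (auto intro!: mult_pos_pos spacing_pos)
  then show ?thesis using grid_particle_diff_cross[OF assms False] by simp
qed

lemma grid_particle_separation:
  assumes "i < C K" "j < C K" "i \<noteq> j"
  shows "spacing d C (cell C i) / 2 \<le> \<bar>grid_particle a d C i - grid_particle a d C j\<bar>"
    and "C (cell C i) < i \<Longrightarrow> Suc i < C (Suc (cell C i)) \<Longrightarrow>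
      spacing d C (cell C i) \<le> \<bar>grid_particle a d C i - grid_particle a d C j\<bar>"
proof -
  \<comment> \<open>Both claims are proved together, with \<open>c\<close> as the number of spacings.\<close>
  define c where "c = (if C (cell C i) < i \<and> Suc i < C (Suc (cell C i)) then 1 else 1/2 :: real)"
  note bi = cell_bounds[OF assms(1)] and bj = cell_bounds[OF assms(2)]
  have s: "0 < spacing d C (cell C i)" "0 < spacing d C (cell C j)"
    using bi bj by (auto intro!: spacing_pos)
  have "spacing d C (cell C i) * c \<le> \<bar>grid_particle a d C i - grid_particle a d C j\<bar>"
  proof (cases "cell C i = cell C j")
    case True
    have "spacing d C (cell C i) * c \<le> spacing d C (cell C i) * 1"
      using s by (intro mult_left_mono) (auto simp: c_def)
    also have "\<dots> \<le> \<bar>grid_particle a d C i - grid_particle a d C j\<bar>"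
      using grid_particle_diff_same[of i j] grid_particle_diff_same[of j i] assms True
      by (cases "i < j") auto
    finally show ?thesis .
  next
    case False
    show ?thesis
    proof (cases "i < j")
      case True
      have "spacing d C (cell C i) * c \<le> spacing d C (cell C i) * (real (C (Suc (cell C i))) - real i - 1 / 2)"
        using s bi by (intro mult_left_mono) (auto simp: c_def)
      moreover have "0 \<le> spacing d C (cell C j) * (real j - real (C (cell C j)) + 1 / 2)"
        using s bj by (intro mult_nonneg_nonneg) auto
      ultimately show ?thesis using grid_particle_diff_cross[OF True assms(2) False] by simp
    next
      case ji: False
      then have ji: "j < i" using assms by simp
      have "spacing d C (cell C i) * c \<le> spacing d C (cell C i) * (real i - real (C (cell C i)) + 1 / 2)"
        using s bi by (intro mult_left_mono) (auto simp: c_def)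
      moreover have "0 \<le> spacing d C (cell C j) * (real (C (Suc (cell C j))) - real j - 1 / 2)"
        using s bj by (intro mult_nonneg_nonneg) auto
      ultimately show ?thesis using grid_particle_diff_cross[OF ji assms(1)] False by simp
    qed
  qed
  then show "spacing d C (cell C i) / 2 \<le> \<bar>grid_particle a d C i - grid_particle a d C j\<bar>"
    and "C (cell C i) < i \<Longrightarrow> Suc i < C (Suc (cell C i)) \<Longrightarrow>
      spacing d C (cell C i) \<le> \<bar>grid_particle a d C i - grid_particle a d C j\<bar>"
    using s by (auto simp: c_def split: if_splits)
qed

end

definition grid_particles :: "real \<Rightarrow> real \<Rightarrow> (nat \<Rightarrow> nat) \<Rightarrow> nat \<Rightarrow> real list" where
  "grid_particles a d C N = map (grid_particle a d C) [0..<N]"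

lemma grid_particles_valid:
  assumes "0 < d" "mono C" "C 0 = 0" "C K = N"
  shows "length (grid_particles a d C N) = N" "sorted_wrt (<) (grid_particles a d C N)"
    "set (grid_particles a d C N) \<subseteq> {a..a + d * real K}"
  using grid_particle_strict_mono[OF assms(1-3)] grid_particle_range[OF assms(1-3)] assms(4)
  by (auto simp: grid_particles_def sorted_wrt_iff_nth_less)

lemma sum_lessThan_blocks:
  fixes f :: "nat \<Rightarrow> 'a :: comm_monoid_add"
  assumes "mono C" "C 0 = 0"
  shows "sum f {..<C K} = (\<Sum>k<K. sum f {C k..<C (Suc k)})"
proof (induction K)
  case (Suc K)
  have "sum f {0..<C (Suc K)} = sum f {0..<C K} + sum f {C K..<C (Suc K)}"
    by (rule sum.atLeastLessThan_concat[symmetric]) (use monoD[OF assms(1), of K "Suc K"] in auto)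
  then show ?case using Suc by (simp add: atLeast0LessThan)
qed (simp add: assms)

text \<open>A cell with \<open>n\<close> particles has spacing \<open>d / n\<close>. Charging every particle for an interval of this
length gives the first summand. Only the first and the last particle of the cell may have a
shorter interval, of at least half the length; charging them for it in addition gives the
second summand.\<close>

lemma (in internal_energy) discrete_energy_grid_le:
  assumes d: "0 < d" and C: "mono C" "C 0 = 0" "C K = N" and N: "2 \<le> N"
  shows "discrete_energy N H (empirical (grid_particles a d C N))
    \<le> (\<Sum>k<K. d * H (real (C (Suc k) - C k) / (real N * d))
           + d / real (C (Suc k) - C k) * H (2 * real (C (Suc k) - C k) / (real N * d)))"
proof -
  let ?xs = "grid_particles a d C N"
  note valid = grid_particles_valid[OF d C, of a]
  have nth: "?xs ! i = grid_particle a d C i" if "i < N" for i using that by (simp add: grid_particles_def)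
  let ?e = "\<lambda>i. gap ?xs i * H (1 / real N / gap ?xs i)"
  have "discrete_energy N H (empirical ?xs) = (\<Sum>i<N. ?e i)"
    using discrete_energy_eq[of ?xs H] valid N by simp
  also have "\<dots> = (\<Sum>k<K. sum ?e {C k..<C (Suc k)})"
    using sum_lessThan_blocks[OF C(1,2), of ?e K] C(3) by simp
  also have "\<dots> \<le> (\<Sum>k<K. d * H (real (C (Suc k) - C k) / (real N * d))
           + d / real (C (Suc k) - C k) * H (2 * real (C (Suc k) - C k) / (real N * d)))"
  proof (rule sum_mono)
    fix k assume k: "k \<in> {..<K}"
    define n where "n = C (Suc k) - C k"
    define s where "s = spacing d C k"
    show "sum ?e {C k..<C (Suc k)} \<le> d * H (real (C (Suc k) - C k) / (real N * d))
           + d / real (C (Suc k) - C k) * H (2 * real (C (Suc k) - C k) / (real N * d))"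
    proof (cases "C k < C (Suc k)")
      case False
      then show ?thesis using d nonneg zero by simp
    next
      case True
      then have n: "n > 0" by (simp add: n_def)
      have s: "s > 0" "s = d / real n" using spacing_pos[OF d C(1,2) True] by (simp_all add: s_def spacing_def n_def)
      define full where "full = s * H (1 / real N / s)"
      define half where "half = s / 2 * H (1 / real N / (s / 2))"
      have pos: "0 \<le> full" "0 \<le> half" using s(1) nonneg by (auto simp: full_def half_def)
      have le: "?e i \<le> full + (if i = C k then half else 0) + (if i = C (Suc k) - 1 then half else 0)"
        if i: "i \<in> {C k..<C (Suc k)}" for i
      proof -
        have "C (Suc k) \<le> C K" using k by (intro monoD[OF C(1)]) auto
        then have iN: "i < C K" "i < N" using i C(3) by auto
        have ck: "cell C i = k" using cell_eq[OF d C(1,2)] i by simp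
        note sep = grid_particle_separation[OF d C(1,2) iN(1), where a = a, unfolded ck, folded s_def]
        have "s / 2 \<le> gap ?xs i"
          by (rule le_gap) (use valid N sep(1) C(3) nth iN in auto)
        then have h: "?e i \<le> half"
          unfolding half_def by (intro perspective_antimono) (use s(1) in auto)
        show ?thesis
        proof (cases "C k < i \<and> Suc i < C (Suc k)")
          case True
          have "s \<le> gap ?xs i"
            by (rule le_gap) (use valid N sep(2) C(3) nth iN True in auto)
          then have "?e i \<le> full"
            unfolding full_def by (intro perspective_antimono) (use s(1) in auto)
          moreover have "full \<le> full + (if i = C k then half else 0) + (if i = C (Suc k) - 1 then half else 0)"
            using pos by auto
          ultimately show ?thesis by (rule order_trans)
        next
          case False
          then have "i = C k \<or> i = C (Suc k) - 1" using i by auto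
          then have "half \<le> full + (if i = C k then half else 0) + (if i = C (Suc k) - 1 then half else 0)"
            using pos by auto
          with h show ?thesis by (rule order_trans)
        qed
      qed
      have "sum ?e {C k..<C (Suc k)} \<le> (\<Sum>i\<in>{C k..<C (Suc k)}.
          full + (if i = C k then half else 0) + (if i = C (Suc k) - 1 then half else 0))"
        by (rule sum_mono) (rule le)
      also have "\<dots> = real n * full + half + half"
        using True by (simp add: sum.distrib n_def)
      also have "real n * full = d * H (real n / (real N * d))"
        using n s(2) d by (simp add: full_def)
      also have "half = d / (2 * real n) * H (2 * real n / (real N * d))"
        using n s(2) d by (simp add: half_def mult_ac)
      finally show ?thesis by (simp add: n_def[symmetric])
    qed
  qed
  finally show ?thesis .
qed

section \<open>Quantile coupling with the particles\<close>

abbreviation unit_interval :: "real measure" where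
  "unit_interval \<equiv> restrict_space lborel {0<..<1}"

text \<open>The interval \<open>(i / N, (i + 1) / N]\<close> of quantile levels is assigned to particle \<open>i\<close>. The intervals are
closed on the right to match the quantile function \<open>Inf {x. s \<le> cdf \<rho> x}\<close>, for which the levels in
\<open>(cdf \<rho> x, cdf \<rho> y]\<close> are those with quantile in \<open>(x, y]\<close>.\<close>

definition slot :: "nat \<Rightarrow> real \<Rightarrow> nat" where
  "slot N s = nat \<lceil>real N * s\<rceil> - 1"

lemma slot_less:
  assumes "0 < N" "0 < s" "s < 1" shows "slot N s < N"
proof -
  have "real N * s \<le> real N" using assms by (simp add: mult_left_le)
  then have "nat \<lceil>real N * s\<rceil> \<le> N" by (simp add: ceiling_le_iff)
  moreover have "0 < real N * s" using assms by simp
  then have "0 < \<lceil>real N * s\<rceil>" by (rule zero_less_ceiling[THEN iffD2])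
  ultimately show ?thesis unfolding slot_def by linarith
qed

lemma slot_eq_iff:
  assumes "0 < N" "0 < s"
  shows "slot N s = i \<longleftrightarrow> real i / real N < s \<and> s \<le> (real i + 1) / real N"
proof -
  have "0 < real N * s" using assms by simp
  then have "0 < \<lceil>real N * s\<rceil>" by (rule zero_less_ceiling[THEN iffD2])
  then have "slot N s = i \<longleftrightarrow> \<lceil>real N * s\<rceil> = int i + 1" unfolding slot_def by linarith
  also have "\<dots> \<longleftrightarrow> real i < real N * s \<and> real N * s \<le> real i + 1"
    by (auto simp: ceiling_eq_iff)
  finally show ?thesis using assms by (simp add: field_simps)
qed

lemma distr_slot:
  assumes N: "0 < N"
  shows "slot N \<in> unit_interval \<rightarrow>\<^sub>M count_space {..<N}"
    and "distr unit_interval (count_space {..<N}) (slot N) = uniform_count_measure {..<N}"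
proof -
  have vim: "slot N -` {i} \<inter> space unit_interval = {real i / real N <.. (real i + 1) / real N} \<inter> {0<..<1}" for i
  proof (rule set_eqI)
    fix s show "s \<in> slot N -` {i} \<inter> space unit_interval
      \<longleftrightarrow> s \<in> {real i / real N <.. (real i + 1) / real N} \<inter> {0<..<1}"
      using slot_eq_iff[OF N, of s i] by (cases "0 < s") (simp_all add: space_restrict_space)
  qed
  show m: "slot N \<in> unit_interval \<rightarrow>\<^sub>M count_space {..<N}"
    unfolding measurable_count_space_eq2[OF finite_lessThan] vim
    using slot_less[OF N] by (auto simp: space_restrict_space sets_restrict_space)
  show "distr unit_interval (count_space {..<N}) (slot N) = uniform_count_measure {..<N}"
  proof (rule measure_eqI_finite)
    fix i assume i: "i \<in> {..<N}"
    have "emeasure (distr unit_interval (count_space {..<N}) (slot N)) {i}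
      = emeasure unit_interval (slot N -` {i} \<inter> space unit_interval)"
      using i by (intro emeasure_distr[OF m]) auto
    also have "\<dots> = emeasure lborel ({real i / real N <.. (real i + 1) / real N} \<inter> {0<..<1})"
      unfolding vim by (rule emeasure_restrict_space) auto
    also have "\<dots> = emeasure lborel {real i / real N <..< (real i + 1) / real N}"
    proof (rule emeasure_eq_AE)
      have b: "0 \<le> real i / real N" "(real i + 1) / real N \<le> 1" using i N by auto
      show "AE x in lborel. x \<in> {real i / real N <.. (real i + 1) / real N} \<inter> {0<..<1}
        \<longleftrightarrow> x \<in> {real i / real N <..< (real i + 1) / real N}"
        using AE_lborel_singleton[of "(real i + 1) / real N"] by eventually_elim
          (use b in \<open>auto intro: le_less_trans[OF b(1)]\<close>)
    qed auto
    also have "\<dots> = ennreal (1 / real N)"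
      using N by (subst emeasure_lborel_Ioo) (auto simp: divide_right_mono diff_divide_distrib[symmetric])
    also have "\<dots> = emeasure (uniform_count_measure {..<N}) {i}"
      using i by (subst emeasure_uniform_count_measure) (auto simp: divide_ennreal)
    finally show "emeasure (distr unit_interval (count_space {..<N}) (slot N)) {i}
      = emeasure (uniform_count_measure {..<N}) {i}" .
  qed (auto simp: sets_uniform_count_measure)
qed

lemma distr_empirical:
  assumes "xs \<noteq> []"
  shows "(\<lambda>s. xs ! slot (length xs) s) \<in> borel_measurable unit_interval"
    and "distr unit_interval borel (\<lambda>s. xs ! slot (length xs) s) = empirical xs"
proof -
  have N: "0 < length xs" using assms by simp
  have m: "(!) xs \<in> count_space {..<length xs} \<rightarrow>\<^sub>M borel" by simp
  show "(\<lambda>s. xs ! slot (length xs) s) \<in> borel_measurable unit_interval"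
    using measurable_comp[OF distr_slot(1)[OF N] m] by (simp add: comp_def)
  show "distr unit_interval borel (\<lambda>s. xs ! slot (length xs) s) = empirical xs"
    unfolding empirical_def distr_slot(2)[OF N, symmetric]
    by (subst distr_distr[OF m distr_slot(1)[OF N]]) (simp add: comp_def)
qed

lemma transport_cost_le_quantile:
  assumes xs: "xs \<noteq> []" and Y: "Y \<in> borel_measurable unit_interval" "distr unit_interval borel Y = \<rho>"
  shows "transport_cost p (empirical xs) \<rho>
    \<le> (\<integral>\<^sup>+s. ennreal (\<bar>xs ! slot (length xs) s - Y s\<bar> powr p) \<partial>unit_interval)"
proof -
  let ?X = "\<lambda>s. xs ! slot (length xs) s"
  note X = distr_empirical[OF xs]
  note [measurable] = X(1) Y(1)
  define \<gamma> where "\<gamma> = distr unit_interval (borel \<Otimes>\<^sub>M borel) (\<lambda>s. (?X s, Y s))"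
  have "\<gamma> \<in> couplings (empirical xs) \<rho>"
    unfolding couplings_def \<gamma>_def using X Y by (auto simp: distr_distr comp_def)
  then have "transport_cost p (empirical xs) \<rho> \<le> (\<integral>\<^sup>+z. ennreal (\<bar>fst z - snd z\<bar> powr p) \<partial>\<gamma>)"
    unfolding transport_cost_def by (rule INF_lower)
  also have "\<dots> = (\<integral>\<^sup>+s. ennreal (\<bar>?X s - Y s\<bar> powr p) \<partial>unit_interval)"
    unfolding \<gamma>_def by (subst nn_integral_distr) auto
  finally show ?thesis .
qed

text \<open>\<open>level \<rho> a d K k\<close> is the mass to be placed in the first \<open>k\<close> of \<open>K\<close> cells. The values \<open>0\<close> and \<open>1\<close> at the
two ends assign the mass left and right of the grid to the outer cells.\<close>

definition level :: "real measure \<Rightarrow> real \<Rightarrow> real \<Rightarrow> nat \<Rightarrow> nat \<Rightarrow> real" where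
  "level \<rho> a d K k = (if k = 0 then 0 else if K \<le> k then 1 else cdf \<rho> (a + d * real k))"

definition level_index :: "real measure \<Rightarrow> real \<Rightarrow> real \<Rightarrow> nat \<Rightarrow> nat \<Rightarrow> nat \<Rightarrow> nat" where
  "level_index \<rho> a d K N k = nat \<lceil>real N * level \<rho> a d K k\<rceil>"

text \<open>For \<open>a \<le> b\<close> this is the distance from \<open>y\<close> to the interval \<open>[a, b]\<close>, that is, the part of
the displacement of \<open>y\<close> caused by cutting off the tails.\<close>

definition excess :: "real \<Rightarrow> real \<Rightarrow> real \<Rightarrow> real" where
  "excess a b y = max 0 (max (a - y) (y - b))"

lemma excess_nonneg [simp]: "0 \<le> excess a b y"
  by (simp add: excess_def)

lemma excess_eq_zero: "y \<in> {a..b} \<Longrightarrow> excess a b y = 0"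
  by (auto simp: excess_def)

lemma excess_measurable [measurable]: "excess a b \<in> borel_measurable borel"
  unfolding excess_def by measurable

context
  fixes \<rho> :: "real measure" and a d :: real and K :: nat
  assumes \<rho>: "real_distribution \<rho>" and d: "0 < d" and K: "0 < K"
begin

interpretation cdf_distribution \<rho>
  unfolding cdf_distribution_def by (rule \<rho>)

lemma level_mono: "mono (level \<rho> a d K)"
proof (rule monoI)
  fix k l :: nat assume "k \<le> l"
  then show "level \<rho> a d K k \<le> level \<rho> a d K l"
    using K d by (auto simp: level_def cdf_nonneg cdf_bounded_prob intro!: cdf_nondecreasing)
qed

lemma level_bounds: "0 \<le> level \<rho> a d K k" "level \<rho> a d K k \<le> 1"
  by (auto simp: level_def cdf_nonneg cdf_bounded_prob)

lemma level_index_props: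
  "mono (level_index \<rho> a d K N)" "level_index \<rho> a d K N 0 = 0" "level_index \<rho> a d K N K = N"
proof -
  show "mono (level_index \<rho> a d K N)"
  proof (rule monoI)
    fix k l :: nat assume "k \<le> l"
    then have "level \<rho> a d K k \<le> level \<rho> a d K l" by (rule monoD[OF level_mono])
    then have "real N * level \<rho> a d K k \<le> real N * level \<rho> a d K l" by (rule mult_left_mono) simp
    then show "level_index \<rho> a d K N k \<le> level_index \<rho> a d K N l"
      unfolding level_index_def by (intro nat_mono ceiling_mono)
  qed
qed (use K in \<open>auto simp: level_index_def level_def\<close>)

lemma level_index_tendsto: "(\<lambda>N. real (level_index \<rho> a d K N k) / real N) \<longlonglongrightarrow> level \<rho> a d K k"
proof (rule tendsto_sandwich)
  let ?c = "level \<rho> a d K k"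
  have c: "real N * ?c \<le> real (level_index \<rho> a d K N k)" "real (level_index \<rho> a d K N k) \<le> real N * ?c + 1" for N
  proof -
    have "0 \<le> real N * ?c" using level_bounds by simp
    then have "real (level_index \<rho> a d K N k) = of_int \<lceil>real N * ?c\<rceil>"
      unfolding level_index_def by (intro of_nat_nat) simp
    then show "real N * ?c \<le> real (level_index \<rho> a d K N k)" "real (level_index \<rho> a d K N k) \<le> real N * ?c + 1"
      by linarith+
  qed
  show "\<forall>\<^sub>F N in sequentially. ?c \<le> real (level_index \<rho> a d K N k) / real N"
    using eventually_gt_at_top[of 0] by eventually_elim (use c in \<open>simp add: pos_le_divide_eq mult.commute\<close>)
  show "\<forall>\<^sub>F N in sequentially. real (level_index \<rho> a d K N k) / real N \<le> ?c + 1 / real N"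
    using eventually_gt_at_top[of 0] by eventually_elim (use c in \<open>simp add: pos_divide_le_eq distrib_right distrib_left mult.commute\<close>)
  have "(\<lambda>N. ?c + 1 / real N) \<longlonglongrightarrow> ?c + 0"
    by (intro tendsto_add tendsto_const lim_1_over_n)
  then show "(\<lambda>N. ?c + 1 / real N) \<longlonglongrightarrow> ?c" by simp
qed simp

lemma level_cell_exists:
  assumes "0 < s" "s < 1"
  obtains k where "k < K" "level \<rho> a d K k < s" "s \<le> level \<rho> a d K (Suc k)"
proof -
  let ?P = "\<lambda>k. s \<le> level \<rho> a d K k"
  have P: "?P K" using assms K by (simp add: level_def)
  define m where "m = (LEAST k. ?P k)"
  have m: "?P m" unfolding m_def by (rule LeastI[of ?P, OF P])
  have "m \<le> K" unfolding m_def by (rule Least_le) (rule P)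
  have "m \<noteq> 0" using m assms by (auto simp: level_def intro: ccontr)
  then obtain k where k: "m = Suc k" by (cases m) auto
  have "\<not> ?P k" using not_less_Least[of k ?P] k by (simp add: m_def)
  then show ?thesis using that[of k] m k \<open>m \<le> K\<close> by auto
qed

text \<open>Rounding may put a particle into the wrong cell only for levels \<open>s\<close> within \<open>1 / N\<close> of the lower
level of the cell.\<close>

lemma slot_eventually_in_cell:
  assumes s: "0 < s" "s < 1" "level \<rho> a d K k < s" "s \<le> level \<rho> a d K (Suc k)"
  shows "\<forall>\<^sub>F N in sequentially. level_index \<rho> a d K N k \<le> slot N s \<and> slot N s < level_index \<rho> a d K N (Suc k)"
proof -
  have "LIM N sequentially. (s - level \<rho> a d K k) * real N :> at_top"
    by (rule filterlim_tendsto_pos_mult_at_top[OF tendsto_const _ filterlim_real_sequentially]) (use s in simp)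
  then have "\<forall>\<^sub>F N in sequentially. 1 \<le> (s - level \<rho> a d K k) * real N"
    by (simp add: filterlim_at_top)
  then show ?thesis
    using eventually_gt_at_top[of 0]
  proof eventually_elim
    case (elim N)
    have "0 < real N * s" using elim s by simp
    then have pos: "0 < \<lceil>real N * s\<rceil>" by (rule zero_less_ceiling[THEN iffD2])
    have "real N * level \<rho> a d K k + 1 \<le> real N * s" using elim by (simp add: algebra_simps)
    then have "\<lceil>real N * level \<rho> a d K k\<rceil> + 1 \<le> \<lceil>real N * s\<rceil>"
      by (metis ceiling_mono ceiling_add_one)
    then have "level_index \<rho> a d K N k \<le> slot N s" unfolding level_index_def slot_def by linarith
    moreover have "real N * s \<le> real N * level \<rho> a d K (Suc k)" using s by (intro mult_left_mono) auto
    then have "\<lceil>real N * s\<rceil> \<le> \<lceil>real N * level \<rho> a d K (Suc k)\<rceil>" by (rule ceiling_mono)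
    then have "slot N s < level_index \<rho> a d K N (Suc k)"
      using pos unfolding level_index_def slot_def by linarith
    ultimately show ?case by simp
  qed
qed

lemma quantile_close:
  assumes s: "0 < s" "s < 1" "level \<rho> a d K k < s" "s \<le> level \<rho> a d K (Suc k)" and k: "k < K"
    and x: "a + d * real k \<le> x" "x \<le> a + d * (real k + 1)"
  shows "\<bar>x - I s\<bar> \<le> d + excess a (a + d * real K) (I s)"
proof -
  have lo: "k = 0 \<or> a + d * real k < I s"
  proof (cases "k = 0")
    case False
    then have "\<not> s \<le> C (a + d * real k)" using s(3) k by (simp add: level_def)
    then have "\<not> I s \<le> a + d * real k" using pseudoinverse[OF s(1,2), of "a + d * real k"] by blast
    then show ?thesis by (intro disjI2) (rule not_le[THEN iffD1])
  qed simp
  have hi: "Suc k = K \<or> I s \<le> a + d * (real k + 1)"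
  proof (cases "Suc k = K")
    case False
    then have "s \<le> C (a + d * real (Suc k))" using s(4) k by (simp add: level_def)
    then have "I s \<le> a + d * real (Suc k)" by (rule pseudoinverse[OF s(1,2), THEN iffD1])
    then show ?thesis by (simp add: add.commute)
  qed simp
  have "I s - x \<le> d + excess a (a + d * real K) (I s)"
    using hi
  proof
    assume "Suc k = K"
    then have "a + d * real K = a + d * real k + d" by (auto simp: algebra_simps)
    then show ?thesis using x by (auto simp: excess_def)
  next
    assume "I s \<le> a + d * (real k + 1)"
    then show ?thesis using x by (simp add: excess_def distrib_left)
  qed
  moreover have "x - I s \<le> d + excess a (a + d * real K) (I s)"
    using lo
  proof
    assume "k = 0"
    then show ?thesis using x by (auto simp: excess_def)
  next
    assume "a + d * real k < I s"
    then show ?thesis using x by (simp add: excess_def distrib_left)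
  qed
  ultimately show ?thesis by linarith
qed

text \<open>Levels whose particle lies in the right cell contribute at most the integral on the right. On
the others, the bad ones, the displacement is bounded by an integrable function
independently of \<open>N\<close>, and every level is bad for finitely many \<open>N\<close> only, so dominated
convergence applies.\<close>

lemma eventually_transport_cost_grid_le:
  assumes p: "0 < p"
    and fin: "(\<integral>\<^sup>+y. ennreal ((d * real K + excess a (a + d * real K) y) powr p) \<partial>\<rho>) < \<infinity>"
    and e: "0 < e"
  shows "\<forall>\<^sub>F N in sequentially.
    transport_cost p (empirical (grid_particles a d (level_index \<rho> a d K N) N)) \<rho>
    \<le> (\<integral>\<^sup>+y. ennreal ((d + excess a (a + d * real K) y) powr p) \<partial>\<rho>) + ennreal e"
proof -
  let ?D = "\<lambda>y. excess a (a + d * real K) y"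
  let ?x = "\<lambda>N. grid_particles a d (level_index \<rho> a d K N) N"
  let ?X = "\<lambda>N s. ?x N ! slot N s"
  define bad where "bad N s = (if \<bar>?X N s - I s\<bar> \<le> d + ?D (I s) then 0 else \<bar>?X N s - I s\<bar> powr p)" for N s
  have Im[measurable]: "I \<in> borel_measurable unit_interval"
    using measurable_CI by (subst measurable_cong_sets[OF sets_restrict_space_cong[OF sets_lborel] refl])
  have len: "length (?x N) = N" for N by (simp add: grid_particles_def)
  have Xm[measurable]: "?X N \<in> borel_measurable unit_interval" if "0 < N" for N
    using distr_empirical(1)[of "?x N"] that len[of N] by (cases "?x N = []") auto
  have nth: "?X N s = grid_particle a d (level_index \<rho> a d K N) (slot N s)" if "0 < N" "0 < s" "s < 1" for N s
    using slot_less[OF that] by (simp add: grid_particles_def)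
  have int_distr: "(\<integral>\<^sup>+s. f (I s) \<partial>unit_interval) = (\<integral>\<^sup>+y. f y \<partial>\<rho>)" if [measurable]: "f \<in> borel_measurable borel" for f
    by (subst distr_I_eq_M[symmetric], subst nn_integral_distr) auto
  have badm: "(\<lambda>s. ennreal (bad (Suc N) s)) \<in> borel_measurable unit_interval" for N
    unfolding bad_def using Xm[of "Suc N"] by measurable
  have "(\<lambda>N. \<integral>\<^sup>+s. ennreal (bad (Suc N) s) \<partial>unit_interval) \<longlonglongrightarrow> (\<integral>\<^sup>+s. 0 \<partial>unit_interval)"
  proof (rule nn_integral_dominated_convergence[where w = "\<lambda>s. ennreal ((d * real K + ?D (I s)) powr p)"])
    show "(\<integral>\<^sup>+s. ennreal ((d * real K + ?D (I s)) powr p) \<partial>unit_interval) < \<infinity>"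
      using fin int_distr[of "\<lambda>y. ennreal ((d * real K + ?D y) powr p)"] by simp
    show "AE s in unit_interval. ennreal (bad (Suc N) s) \<le> ennreal ((d * real K + ?D (I s)) powr p)" for N
    proof (rule AE_I2)
      fix s assume "s \<in> space unit_interval"
      then have s: "0 < s" "s < 1" by (auto simp: space_restrict_space)
      have "?X (Suc N) s \<in> {a..a + d * real K}"
        using grid_particle_range[OF d level_index_props(1,2), of "slot (Suc N) s" "Suc N" K a]
          slot_less[of "Suc N" s] level_index_props(3) s nth[of "Suc N" s] by simp
      then have "\<bar>?X (Suc N) s - I s\<bar> \<le> d * real K + ?D (I s)"
        by (auto simp: excess_def abs_le_iff)
      then have "\<bar>?X (Suc N) s - I s\<bar> powr p \<le> (d * real K + ?D (I s)) powr p"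
        using p by (intro powr_mono2) auto
      then show "ennreal (bad (Suc N) s) \<le> ennreal ((d * real K + ?D (I s)) powr p)"
        by (auto simp: bad_def intro: ennreal_leI)
    qed
    show "AE s in unit_interval. (\<lambda>N. ennreal (bad (Suc N) s)) \<longlonglongrightarrow> 0"
    proof (rule AE_I2)
      fix s assume "s \<in> space unit_interval"
      then have s: "0 < s" "s < 1" by (auto simp: space_restrict_space)
      obtain k where k: "k < K" "level \<rho> a d K k < s" "s \<le> level \<rho> a d K (Suc k)"
        using level_cell_exists[OF s] .
      have "\<forall>\<^sub>F N in sequentially. bad N s = 0"
        using slot_eventually_in_cell[OF s k(2,3)] eventually_gt_at_top[of 0]
      proof eventually_elim
        case (elim N)
        have c: "cell (level_index \<rho> a d K N) (slot N s) = k"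
          using cell_eq[OF d level_index_props(1,2)] elim by simp
        have "slot N s < level_index \<rho> a d K N K"
          using slot_less[of N s] elim s by (simp add: level_index_props)
        note b = grid_particle_bounds[OF d level_index_props(1,2) this, of a, unfolded c]
        then show ?case
          using quantile_close[OF s k(2,3,1)] nth[of N s] elim s by (simp add: bad_def)
      qed
      then have "(\<lambda>N. ennreal (bad N s)) \<longlonglongrightarrow> 0"
        by (intro tendsto_eventually) (auto elim: eventually_mono)
      then show "(\<lambda>N. ennreal (bad (Suc N) s)) \<longlonglongrightarrow> 0" by (rule LIMSEQ_Suc)
    qed
  qed (use badm in auto)
  then have "(\<lambda>N. \<integral>\<^sup>+s. ennreal (bad (Suc N) s) \<partial>unit_interval) \<longlonglongrightarrow> 0" by simp
  then have "\<forall>\<^sub>F N in sequentially. (\<integral>\<^sup>+s. ennreal (bad (Suc N) s) \<partial>unit_interval) < ennreal e"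
    by (rule order_tendstoD) (use e in simp)
  then have "\<forall>\<^sub>F N in sequentially. transport_cost p (empirical (?x (Suc N))) \<rho>
    \<le> (\<integral>\<^sup>+y. ennreal ((d + ?D y) powr p) \<partial>\<rho>) + ennreal e"
  proof eventually_elim
    case (elim N)
    have "transport_cost p (empirical (?x (Suc N))) \<rho>
      \<le> (\<integral>\<^sup>+s. ennreal (\<bar>?X (Suc N) s - I s\<bar> powr p) \<partial>unit_interval)"
      using transport_cost_le_quantile[of "?x (Suc N)" I \<rho> p] Im distr_I_eq_M len[of "Suc N"]
      by (cases "?x (Suc N) = []") auto
    also have "\<dots> \<le> (\<integral>\<^sup>+s. ennreal ((d + ?D (I s)) powr p) + ennreal (bad (Suc N) s) \<partial>unit_interval)"
      using p by (intro nn_integral_mono)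
        (auto simp: bad_def add_increasing intro!: ennreal_leI powr_mono2)
    also have "\<dots> = (\<integral>\<^sup>+s. ennreal ((d + ?D (I s)) powr p) \<partial>unit_interval)
        + (\<integral>\<^sup>+s. ennreal (bad (Suc N) s) \<partial>unit_interval)"
      by (rule nn_integral_add) (use badm in measurable)
    also have "\<dots> \<le> (\<integral>\<^sup>+y. ennreal ((d + ?D y) powr p) \<partial>\<rho>) + ennreal e"
      using elim int_distr[of "\<lambda>y. ennreal ((d + ?D y) powr p)"] by (intro add_mono) auto
    finally show ?case .
  qed
  then show ?thesis by (subst (asm) eventually_sequentially_Suc)
qed

end

section \<open>Energy of the grid for many particles\<close>

text \<open>In \<open>discrete_energy_grid_le\<close> the first summand converges to \<open>d H (m / d)\<close>, where \<open>m\<close> is the mass of the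
cell, and the second one vanishes: if \<open>m > 0\<close> since the number of particles in the cell tends
to infinity, and if \<open>m = 0\<close> since \<open>H\<close> is continuous with \<open>H 0 = 0\<close>.\<close>

lemma (in internal_energy) eventually_discrete_energy_grid_le:
  assumes \<rho>: "real_distribution \<rho>" and d: "0 < d" and K: "0 < K" and e: "0 < e"
  shows "\<forall>\<^sub>F N in sequentially.
    discrete_energy N H (empirical (grid_particles a d (level_index \<rho> a d K N) N))
    \<le> (\<Sum>k<K. d * H ((level \<rho> a d K (Suc k) - level \<rho> a d K k) / d)) + e"
proof -
  let ?n = "\<lambda>N k. level_index \<rho> a d K N (Suc k) - level_index \<rho> a d K N k"
  let ?m = "\<lambda>k. level \<rho> a d K (Suc k) - level \<rho> a d K k"
  let ?T = "\<lambda>N k. d * H (real (?n N k) / (real N * d)) + d / real (?n N k) * H (2 * real (?n N k) / (real N * d))"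
  note props = level_index_props[OF \<rho> d K, of a]
  have T: "(\<lambda>N. ?T N k) \<longlonglongrightarrow> d * H (?m k / d)" for k
  proof -
    have m0: "0 \<le> ?m k" using monoD[OF level_mono[OF \<rho> d K], of k "Suc k" a] by simp
    have "real (?n N k) / real N = real (level_index \<rho> a d K N (Suc k)) / real N - real (level_index \<rho> a d K N k) / real N" for N
      using monoD[OF props(1), of k "Suc k" N] by (simp add: of_nat_diff diff_divide_distrib)
    then have t: "(\<lambda>N. real (?n N k) / real N) \<longlonglongrightarrow> ?m k"
      using level_index_tendsto[OF \<rho> d K] by (simp add: tendsto_diff)
    have Hlim: "(\<lambda>N. H (c * (real (?n N k) / real N) / d)) \<longlonglongrightarrow> H (c * ?m k / d)" if "0 \<le> c" for c
      using d m0 that by (intro continuous_on_tendsto_compose[OF cont] tendsto_intros t) auto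
    have "(\<lambda>N. d / real (?n N k) * H (2 * (real (?n N k) / real N) / d)) \<longlonglongrightarrow> 0"
    proof (cases "?m k = 0")
      case True
      show ?thesis
      proof (rule Lim_null_comparison)
        show "\<forall>\<^sub>F N in sequentially. norm (d / real (?n N k) * H (2 * (real (?n N k) / real N) / d))
          \<le> d * H (2 * (real (?n N k) / real N) / d)"
        proof (rule always_eventually, rule allI)
          fix N
          have "d / real (?n N k) \<le> d" using d by (cases "?n N k") (auto simp: divide_le_eq)
          moreover have H0: "0 \<le> H (2 * (real (?n N k) / real N) / d)" using d by (intro nonneg) auto
          ultimately have "d / real (?n N k) * H (2 * (real (?n N k) / real N) / d)
            \<le> d * H (2 * (real (?n N k) / real N) / d)"
            by (rule mult_right_mono)
          moreover have "0 \<le> d / real (?n N k) * H (2 * (real (?n N k) / real N) / d)"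
            using H0 d by (intro mult_nonneg_nonneg) auto
          ultimately show "norm (d / real (?n N k) * H (2 * (real (?n N k) / real N) / d))
            \<le> d * H (2 * (real (?n N k) / real N) / d)"
            by (simp only: real_norm_def abs_of_nonneg)
        qed
        have "(\<lambda>N. d * H (2 * (real (?n N k) / real N) / d)) \<longlonglongrightarrow> d * H (2 * ?m k / d)"
          by (intro tendsto_mult tendsto_const Hlim) simp
        then show "(\<lambda>N. d * H (2 * (real (?n N k) / real N) / d)) \<longlonglongrightarrow> 0" using True zero by simp
      qed
    next
      case False
      have "LIM N sequentially. real (?n N k) / real N * real N :> at_top"
        by (rule filterlim_tendsto_pos_mult_at_top[OF t _ filterlim_real_sequentially]) (use False m0 in simp)
      moreover have "\<forall>\<^sub>F N in sequentially. real (?n N k) / real N * real N = real (?n N k)"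
        using eventually_gt_at_top[of 0] by eventually_elim simp
      ultimately have "LIM N sequentially. real (?n N k) :> at_top"
        by (rule filterlim_cong[OF refl refl, THEN iffD1, rotated])
      then have "(\<lambda>N. d / real (?n N k)) \<longlonglongrightarrow> 0"
        by (intro tendsto_divide_0[OF tendsto_const] filterlim_at_top_imp_at_infinity)
      then have "(\<lambda>N. d / real (?n N k) * H (2 * (real (?n N k) / real N) / d)) \<longlonglongrightarrow> 0 * H (2 * ?m k / d)"
        by (intro tendsto_mult Hlim) auto
      then show ?thesis by simp
    qed
    then have "(\<lambda>N. d * H (1 * (real (?n N k) / real N) / d) + d / real (?n N k) * H (2 * (real (?n N k) / real N) / d))
      \<longlonglongrightarrow> d * H (1 * ?m k / d) + 0"
      by (intro tendsto_add tendsto_mult tendsto_const Hlim) auto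
    then show ?thesis by simp
  qed
  have "(\<lambda>N. \<Sum>k<K. ?T N k) \<longlonglongrightarrow> (\<Sum>k<K. d * H (?m k / d))"
    by (intro tendsto_sum T)
  then have "\<forall>\<^sub>F N in sequentially. (\<Sum>k<K. ?T N k) < (\<Sum>k<K. d * H (?m k / d)) + e"
    by (rule order_tendstoD) (use e in simp)
  then show ?thesis using eventually_ge_at_top[of 2]
  proof eventually_elim
    case (elim N)
    have "discrete_energy N H (empirical (grid_particles a d (level_index \<rho> a d K N) N)) \<le> (\<Sum>k<K. ?T N k)"
      by (rule discrete_energy_grid_le[OF d props(1,2,3)]) (use elim in simp)
    then show ?case using elim by simp
  qed
qed

section \<open>Moments and mean values on cells\<close>

lemma powr_add_le:
  fixes u v p :: real
  assumes "0 \<le> u" "0 \<le> v" "0 \<le> p"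
  shows "(u + v) powr p \<le> 2 powr p * (u powr p + v powr p)"
proof -
  have "(u + v) powr p \<le> (2 * max u v) powr p" using assms by (intro powr_mono2) auto
  also have "\<dots> = 2 powr p * max u v powr p" using assms by (intro powr_mult)
  also have "max u v powr p \<le> u powr p + v powr p" by (auto simp: max_def)
  finally show ?thesis by simp
qed

lemma P_p_real_distribution: "\<rho> \<in> P_p p \<Omega> \<Longrightarrow> real_distribution \<rho>"
  by (auto simp: P_p_def real_distribution_def real_distribution_axioms_def)

lemma P_p_integral_finite:
  assumes \<rho>: "\<rho> \<in> P_p p \<Omega>" and p: "0 \<le> p" and c: "0 \<le> c"
    and f: "\<And>y. 0 \<le> f y" "\<And>y. f y \<le> c + \<bar>y\<bar>"
  shows "(\<integral>\<^sup>+y. ennreal (f y powr p) \<partial>\<rho>) < \<infinity>"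
proof -
  have sets[measurable_cong]: "sets \<rho> = sets borel" and prob: "prob_space \<rho>"
    and mom: "(\<integral>\<^sup>+x. ennreal (\<bar>x\<bar> powr p) \<partial>\<rho>) < \<infinity>"
    using \<rho> by (auto simp: P_p_def)
  interpret prob_space \<rho> by fact
  have "(\<integral>\<^sup>+y. ennreal (f y powr p) \<partial>\<rho>)
    \<le> (\<integral>\<^sup>+y. ennreal (2 powr p) * (ennreal (c powr p) + ennreal (\<bar>y\<bar> powr p)) \<partial>\<rho>)"
  proof (rule nn_integral_mono)
    fix y
    have "f y powr p \<le> (c + \<bar>y\<bar>) powr p" using f p by (intro powr_mono2) auto
    also have "\<dots> \<le> 2 powr p * (c powr p + \<bar>y\<bar> powr p)" using c p by (intro powr_add_le) auto
    finally have "ennreal (f y powr p) \<le> ennreal (2 powr p * (c powr p + \<bar>y\<bar> powr p))" by (rule ennreal_leI)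
    then show "ennreal (f y powr p) \<le> ennreal (2 powr p) * (ennreal (c powr p) + ennreal (\<bar>y\<bar> powr p))"
      by (simp add: ennreal_mult)
  qed
  also have "\<dots> = ennreal (2 powr p) * (ennreal (c powr p) + (\<integral>\<^sup>+y. ennreal (\<bar>y\<bar> powr p) \<partial>\<rho>))"
    by (simp add: nn_integral_cmult nn_integral_add emeasure_space_1)
  also have "\<dots> < \<infinity>" using mom by (simp add: ennreal_mult_less_top)
  finally show ?thesis .
qed

lemma powr_small:
  fixes e p :: real
  assumes "0 < e" "0 < p"
  obtains r where "0 < r" "\<And>d. 0 \<le> d \<Longrightarrow> d \<le> r \<Longrightarrow> d powr p \<le> e"
proof
  show "0 < e powr (1 / p)" using assms by simp
  fix d :: real assume "0 \<le> d" "d \<le> e powr (1 / p)"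
  then have "d powr p \<le> (e powr (1 / p)) powr p" using assms by (intro powr_mono2) auto
  then show "d powr p \<le> e" using assms by (simp add: powr_powr)
qed

abbreviation grid_cell :: "real \<Rightarrow> real \<Rightarrow> nat \<Rightarrow> real set" where
  "grid_cell a d k \<equiv> {a + d * real k <.. a + d * real (Suc k)}"

lemma grid_cell_disjoint:
  assumes "0 < d" shows "disjoint_family_on (grid_cell a d) J"
proof -
  have "grid_cell a d k \<inter> grid_cell a d l = {}" if "k < l" for k l
  proof -
    have "d * real (Suc k) \<le> d * real l" using assms that by (intro mult_left_mono) auto
    then show ?thesis by auto
  qed
  then show ?thesis unfolding disjoint_family_on_def by (metis Int_commute linorder_neqE_nat)
qed

context internal_energy
begin

text \<open>The inequality between \<open>H\<close> and its supporting line at the mean value \<open>m\<close> is integrated over \<open>A\<close>.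
The terms with negative sign are moved to the other side, so that all integrands are
nonnegative.\<close>

lemma jensen_cell:
  assumes g: "g \<in> borel_measurable borel" "\<And>x. 0 \<le> g x" "\<rho> = density lborel (\<lambda>x. ennreal (g x))"
    and \<rho>: "prob_space \<rho>" and A: "A \<in> fmeasurable lborel" "measure lborel A = d" and d: "0 < d"
  shows "ennreal (d * H (measure \<rho> A / d)) \<le> (\<integral>\<^sup>+x\<in>A. ennreal (H (g x)) \<partial>lborel)"
proof (cases "measure \<rho> A = 0")
  case False
  interpret prob_space \<rho> by fact
  note [measurable] = g(1)
  have [measurable]: "A \<in> sets borel" using A by auto
  have Hm[measurable]: "(\<lambda>x. H (g x)) \<in> borel_measurable borel"
    by (rule borel_measurable_compose[OF g(1,2)])
  define m where "m = measure \<rho> A / d"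
  have m: "0 < m" using False d by (simp add: m_def zero_less_measure_iff)
  obtain c where c: "0 \<le> c" "\<And>y. 0 \<le> y \<Longrightarrow> H m + c * (y - m) \<le> H y"
    using supporting_slope[OF m] by blast
  have eA: "emeasure lborel A = ennreal d" using A by (simp add: emeasure_eq_measure2)
  have gA: "(\<integral>\<^sup>+x. ennreal (g x) * indicator A x \<partial>lborel) = ennreal (m * d)"
  proof -
    have "(\<integral>\<^sup>+x. ennreal (g x) * indicator A x \<partial>lborel) = emeasure \<rho> A"
      unfolding g(3) by (subst emeasure_density) auto
    then show ?thesis using d by (simp add: emeasure_eq_measure m_def)
  qed
  have "ennreal (c * m * d) + ennreal (d * H m)
    = (\<integral>\<^sup>+x. ennreal c * (ennreal (g x) * indicator A x) \<partial>lborel) + (\<integral>\<^sup>+x. ennreal (H m) * indicator A x \<partial>lborel)"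
    using c m d nonneg[of m]
    by (simp add: nn_integral_cmult nn_integral_cmult_indicator gA eA ennreal_mult[symmetric] mult_ac)
  also have "\<dots> = (\<integral>\<^sup>+x. ennreal c * (ennreal (g x) * indicator A x) + ennreal (H m) * indicator A x \<partial>lborel)"
    by (rule nn_integral_add[symmetric]) auto
  also have "\<dots> \<le> (\<integral>\<^sup>+x. ennreal (c * m) * indicator A x + ennreal (H (g x)) * indicator A x \<partial>lborel)"
  proof (rule nn_integral_mono)
    fix x
    have "c * g x + H m \<le> c * m + H (g x)" using c(2)[OF g(2)[of x]] by (simp add: algebra_simps)
    then have "ennreal (c * g x + H m) \<le> ennreal (c * m + H (g x))" by (rule ennreal_leI)
    then have "ennreal c * ennreal (g x) + ennreal (H m) \<le> ennreal (c * m) + ennreal (H (g x))"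
      using c(1) m g(2) nonneg by (simp add: ennreal_mult)
    then show "ennreal c * (ennreal (g x) * indicator A x) + ennreal (H m) * indicator A x
      \<le> ennreal (c * m) * indicator A x + ennreal (H (g x)) * indicator A x"
      by (simp add: indicator_def)
  qed
  also have "\<dots> = ennreal (c * m * d) + (\<integral>\<^sup>+x\<in>A. ennreal (H (g x)) \<partial>lborel)"
    using c m d by (subst nn_integral_add) (auto simp: nn_integral_cmult_indicator eA ennreal_mult[symmetric])
  finally show ?thesis by (simp add: m_def ennreal_add_left_cancel_le)
qed (simp add: zero)

lemma sum_cells_le_energy:
  assumes g: "g \<in> borel_measurable borel" "\<And>x. 0 \<le> g x" "\<rho> = density lborel (\<lambda>x. ennreal (g x))"
    and \<rho>: "prob_space \<rho>" and d: "0 < d" and J: "finite J" "\<And>k. k \<in> J \<Longrightarrow> grid_cell a d k \<subseteq> \<Omega>"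
  shows "ennreal (\<Sum>k\<in>J. d * H (measure \<rho> (grid_cell a d k) / d)) \<le> (\<integral>\<^sup>+x\<in>\<Omega>. ennreal (H (g x)) \<partial>lborel)"
proof -
  have Hm[measurable]: "(\<lambda>x. H (g x)) \<in> borel_measurable borel"
    by (rule borel_measurable_compose[OF g(1,2)])
  have "ennreal (\<Sum>k\<in>J. d * H (measure \<rho> (grid_cell a d k) / d))
    = (\<Sum>k\<in>J. ennreal (d * H (measure \<rho> (grid_cell a d k) / d)))"
    using d nonneg by (intro sum_ennreal[symmetric]) auto
  also have "\<dots> \<le> (\<Sum>k\<in>J. \<integral>\<^sup>+x\<in>grid_cell a d k. ennreal (H (g x)) \<partial>lborel)"
    using d by (intro sum_mono jensen_cell[OF g \<rho>] fmeasurableI) (auto simp: algebra_simps)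
  also have "\<dots> = (\<integral>\<^sup>+x. (\<Sum>k\<in>J. ennreal (H (g x)) * indicator (grid_cell a d k) x) \<partial>lborel)"
    by (rule nn_integral_sum[symmetric]) auto
  also have "\<dots> = (\<integral>\<^sup>+x. ennreal (H (g x)) * indicator (\<Union>k\<in>J. grid_cell a d k) x \<partial>lborel)"
    by (intro nn_integral_cong)
      (simp only: indicator_UN_disjoint[OF J(1) grid_cell_disjoint[OF d]] sum_distrib_left)
  also have "\<dots> \<le> (\<integral>\<^sup>+x\<in>\<Omega>. ennreal (H (g x)) \<partial>lborel)"
    by (intro nn_integral_mono mult_left_mono indicator_leI) (use J(2) in \<open>blast, simp\<close>)
  finally show ?thesis .
qed

lemma energy_finite_density:
  assumes "energy p \<Omega> H \<rho> < \<infinity>"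
  obtains g where "g \<in> borel_measurable borel" "\<And>x. 0 \<le> g x" "\<rho> = density lborel (\<lambda>x. ennreal (g x))"
    "energy p \<Omega> H \<rho> = (\<integral>\<^sup>+x\<in>\<Omega>. ennreal (H (g x)) \<partial>lborel)"
proof -
  have "\<rho> \<in> P_ac p \<Omega>" using assms by (auto simp: energy_def split: if_splits)
  then obtain f where P: "\<rho> \<in> P_p p \<Omega>" and f: "f \<in> borel_measurable lborel" "density lborel f = \<rho>"
    by (auto simp: P_ac_def)
  then have "prob_space \<rho>" by (simp add: P_p_def)
  then obtain g :: "real \<Rightarrow> real" where
    g: "g \<in> borel_measurable borel" "\<And>x. 0 \<le> g x" "\<rho> = density lborel (\<lambda>x. ennreal (g x))"
    by (rule prob_density_real[OF f]) (rule that)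
  moreover have "energy p \<Omega> H \<rho> = (\<integral>\<^sup>+x\<in>\<Omega>. ennreal (H (g x)) \<partial>lborel)"
    using energy_density[OF g(1,2), of p \<Omega> H] P g(3) by simp
  ultimately show ?thesis by (rule that)
qed

section \<open>Choice of the grid and recovery\<close>

lemma grid_choice_interval:
  assumes P: "\<rho> \<in> P_p p {a..b}" and ab: "a < b" and p: "0 < p" and e: "0 < e"
  obtains d K where "0 < d" "0 < K" "a + d * real K = b"
    "(\<integral>\<^sup>+y. ennreal ((d + excess a (a + d * real K) y) powr p) \<partial>\<rho>) \<le> ennreal e"
    "ennreal (\<Sum>k<K. d * H ((level \<rho> a d K (Suc k) - level \<rho> a d K k) / d)) \<le> energy p {a..b} H \<rho> + ennreal e"
proof -
  interpret real_distribution \<rho> by (rule P_p_real_distribution[OF P])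
  have supp: "emeasure \<rho> (- {a..b}) = 0" using P by (simp add: P_p_def)
  obtain r where r: "0 < r" "\<And>d. 0 \<le> d \<Longrightarrow> d \<le> r \<Longrightarrow> d powr p \<le> e" by (rule powr_small[OF e p]) (rule that)
  obtain n where n: "1 / real (Suc n) < r / (b - a)" using nat_approx_posE[of "r / (b - a)"] r ab by auto
  define K where "K = Suc n"
  define d where "d = (b - a) / real K"
  have d: "0 < d" and K: "0 < K" and b: "a + d * real K = b" using ab by (auto simp: d_def K_def)
  have "d \<le> r" using n ab by (simp add: d_def K_def field_simps)
  have "AE y in \<rho>. y \<in> {a..b}" by (rule AE_I[OF _ supp]) auto
  then have "AE y in \<rho>. ennreal ((d + excess a (a + d * real K) y) powr p) = ennreal (d powr p)"
    by eventually_elim (simp add: b excess_eq_zero)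
  then have "(\<integral>\<^sup>+y. ennreal ((d + excess a (a + d * real K) y) powr p) \<partial>\<rho>) = (\<integral>\<^sup>+y. ennreal (d powr p) \<partial>\<rho>)"
    by (rule nn_integral_cong_AE)
  also have "\<dots> = ennreal (d powr p)" using emeasure_space_1 by simp
  also have "\<dots> \<le> ennreal e" using r(2) d \<open>d \<le> r\<close> by (intro ennreal_leI) simp
  finally have cost: "(\<integral>\<^sup>+y. ennreal ((d + excess a (a + d * real K) y) powr p) \<partial>\<rho>) \<le> ennreal e" .
  have "ennreal (\<Sum>k<K. d * H ((level \<rho> a d K (Suc k) - level \<rho> a d K k) / d)) \<le> energy p {a..b} H \<rho> + ennreal e"
  proof (cases "energy p {a..b} H \<rho> < \<infinity>")
    case True
    obtain g where g: "g \<in> borel_measurable borel" "\<And>x. 0 \<le> g x" "\<rho> = density lborel (\<lambda>x. ennreal (g x))"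
      and E: "energy p {a..b} H \<rho> = (\<integral>\<^sup>+x\<in>{a..b}. ennreal (H (g x)) \<partial>lborel)"
      by (rule energy_finite_density[OF True]) (rule that)
    \<comment> \<open>Finite energy excludes an atom at \<open>a\<close>, so also the outer cells carry exactly their own mass.\<close>
    have level: "level \<rho> a d K k = cdf \<rho> (a + d * real k)" if "k \<le> K" for k
    proof -
      have "cdf \<rho> a = 0"
      proof -
        have "{..a} \<in> null_sets \<rho>"
        proof (rule null_sets_subset)
          have "{a} \<in> null_sets (density lborel (\<lambda>x. ennreal (g x)))"
            using absolutely_continuousI_density[of "\<lambda>x. ennreal (g x)" lborel] g(1)
              finite_imp_null_set_lborel[of "{a}"]
            by (auto simp: absolutely_continuous_def)
          then have "{a} \<in> null_sets \<rho>" using g(3) by simp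
          moreover have "- {a..b} \<in> null_sets \<rho>" using supp by (intro null_setsI) auto
          ultimately show "{a} \<union> - {a..b} \<in> null_sets \<rho>" by (rule null_sets.Un)
        qed auto
        then show ?thesis by (simp add: cdf_def measure_eq_0_null_sets)
      qed
      moreover have "cdf \<rho> b = 1"
      proof -
        have "AE y in \<rho>. y \<in> {..b}" by (rule AE_I[OF _ supp]) auto
        then show ?thesis unfolding cdf_def by (subst prob_eq_1) auto
      qed
      ultimately show ?thesis using that b by (auto simp: level_def)
    qed
    have "(\<Sum>k<K. d * H ((level \<rho> a d K (Suc k) - level \<rho> a d K k) / d))
      = (\<Sum>k<K. d * H (measure \<rho> (grid_cell a d k) / d))"
      using d by (intro sum.cong) (auto simp: level cdf_diff_eq)
    also have "ennreal \<dots> \<le> energy p {a..b} H \<rho>"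
      unfolding E
    proof (rule sum_cells_le_energy[OF g prob_space_axioms d])
      fix k assume k: "k \<in> {..<K}"
      have "d * real (Suc k) \<le> d * real K" "0 \<le> d * real k" using d k by (auto intro: mult_left_mono)
      then show "grid_cell a d k \<subseteq> {a..b}" unfolding b[symmetric] by auto
    qed simp
    finally show ?thesis by (rule order_trans) simp
  qed (simp add: not_less top_unique)
  then show ?thesis using that[OF d K b cost] by simp
qed

text \<open>The cell length \<open>d\<close> is fixed first and the half-length \<open>M\<close> of the grid is chosen afterwards: as \<open>M\<close>
grows, the masses of the two outer cells tend to \<open>0\<close>, hence also their energies, and the moved
tails contribute less and less to the cost.\<close>

lemma grid_choice_line:
  assumes P: "\<rho> \<in> P_p p UNIV" and p: "0 < p" and e: "0 < e"
  obtains a d K where "0 < d" "0 < K"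
    "(\<integral>\<^sup>+y. ennreal ((d + excess a (a + d * real K) y) powr p) \<partial>\<rho>) \<le> ennreal e"
    "ennreal (\<Sum>k<K. d * H ((level \<rho> a d K (Suc k) - level \<rho> a d K k) / d)) \<le> energy p UNIV H \<rho> + ennreal e"
proof -
  interpret real_distribution \<rho> by (rule P_p_real_distribution[OF P])
  obtain r where r: "0 < r" "\<And>d. 0 \<le> d \<Longrightarrow> d \<le> r \<Longrightarrow> d powr p \<le> e / (2 * 2 powr p)"
    using powr_small[of "e / (2 * 2 powr p)" p] e p by auto
  obtain n where n: "1 / real (Suc n) < r" using nat_approx_posE[OF r(1)] by auto
  define d where "d = 1 / real (Suc n)"
  have d: "0 < d" "d powr p \<le> e / (2 * 2 powr p)" using r(2)[of d] n by (auto simp: d_def)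
  define tail where "tail M = (\<integral>\<^sup>+y. ennreal (excess (- real M) (real M) y powr p) \<partial>\<rho>)" for M
  have "tail \<longlonglongrightarrow> (\<integral>\<^sup>+y. 0 \<partial>\<rho>)"
    unfolding tail_def
  proof (rule nn_integral_dominated_convergence[where w = "\<lambda>y. ennreal (\<bar>y\<bar> powr p)"])
    show "AE y in \<rho>. ennreal (excess (- real M) (real M) y powr p) \<le> ennreal (\<bar>y\<bar> powr p)" for M
      using p by (intro AE_I2 ennreal_leI powr_mono2) (auto simp: excess_def)
    show "AE y in \<rho>. (\<lambda>M. ennreal (excess (- real M) (real M) y powr p)) \<longlonglongrightarrow> 0"
    proof (rule AE_I2)
      fix y :: real
      have "\<forall>\<^sub>F M in sequentially. \<bar>y\<bar> \<le> real M"
        using filterlim_real_sequentially by (simp add: filterlim_at_top)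
      then have "\<forall>\<^sub>F M in sequentially. ennreal (excess (- real M) (real M) y powr p) = 0"
        by eventually_elim (auto simp: excess_def max_def)
      then show "(\<lambda>M. ennreal (excess (- real M) (real M) y powr p)) \<longlonglongrightarrow> 0" by (rule tendsto_eventually)
    qed
    show "(\<integral>\<^sup>+y. ennreal (\<bar>y\<bar> powr p) \<partial>\<rho>) < \<infinity>" using P by (simp add: P_p_def)
  qed measurable
  then have "tail \<longlonglongrightarrow> 0" by simp
  then have ev1: "\<forall>\<^sub>F M in sequentially. tail M < ennreal (e / (2 * 2 powr p))"
    by (rule order_tendstoD) (use e in simp)
  have small: "\<forall>\<^sub>F M in sequentially. d * H (m M / d) < e / 2"
    if "\<And>M. 0 \<le> m M" "m \<longlonglongrightarrow> 0" for m :: "nat \<Rightarrow> real"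
  proof -
    have "(\<lambda>M. m M / d) \<longlonglongrightarrow> 0 / d" by (intro tendsto_divide that(2) tendsto_const) (use d in simp)
    then have "(\<lambda>M. H (m M / d)) \<longlonglongrightarrow> H 0"
      using that(1) d by (intro continuous_on_tendsto_compose[OF cont]) auto
    then have "(\<lambda>M. d * H (m M / d)) \<longlonglongrightarrow> d * 0"
      unfolding zero by (intro tendsto_mult tendsto_const)
    then show ?thesis by (rule order_tendstoD) (use e in simp)
  qed
  have "LIM M sequentially. - d + real M :> at_top"
    by (intro filterlim_tendsto_add_at_top[OF tendsto_const] filterlim_real_sequentially)
  then have top: "LIM M sequentially. real M - d :> at_top" by simp
  then have "LIM M sequentially. - (real M - d) :> at_bot"
    by (rule filterlim_compose[OF filterlim_uminus_at_bot_at_top])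
  then have "LIM M sequentially. - real M + d :> at_bot" by simp
  then have ev2: "\<forall>\<^sub>F M in sequentially. d * H (cdf \<rho> (- real M + d) / d) < e / 2"
    by (intro small cdf_nonneg filterlim_compose[OF cdf_lim_at_bot])
  from top have "(\<lambda>M. cdf \<rho> (real M - d)) \<longlonglongrightarrow> 1"
    by (rule filterlim_compose[OF cdf_lim_at_top_prob])
  then have "(\<lambda>M. 1 - cdf \<rho> (real M - d)) \<longlonglongrightarrow> 1 - 1" by (intro tendsto_diff tendsto_const)
  then have ev3: "\<forall>\<^sub>F M in sequentially. d * H ((1 - cdf \<rho> (real M - d)) / d) < e / 2"
    by (intro small) (auto simp: cdf_bounded_prob)
  have "\<forall>\<^sub>F M in sequentially. 1 \<le> M \<and> tail M < ennreal (e / (2 * 2 powr p))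
    \<and> d * H (cdf \<rho> (- real M + d) / d) < e / 2 \<and> d * H ((1 - cdf \<rho> (real M - d)) / d) < e / 2"
    by (intro eventually_conj ev1 ev2 ev3 eventually_ge_at_top)
  then obtain M where M: "1 \<le> M" "tail M < ennreal (e / (2 * 2 powr p))"
    "d * H (cdf \<rho> (- real M + d) / d) < e / 2" "d * H ((1 - cdf \<rho> (real M - d)) / d) < e / 2"
    by (auto simp: eventually_sequentially)
  define a where "a = - real M"
  define K where "K = 2 * M * Suc n"
  have K: "2 \<le> K" using M(1) by (simp add: K_def)
  have b: "a + d * real K = real M"
  proof -
    have "real K = 2 * real M * real (Suc n)" unfolding K_def by (simp only: of_nat_mult of_nat_numeral)
    then show ?thesis by (simp add: a_def d_def del: of_nat_Suc)
  qed
  have "(\<integral>\<^sup>+y. ennreal ((d + excess a (a + d * real K) y) powr p) \<partial>\<rho>)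
    \<le> (\<integral>\<^sup>+y. ennreal (2 powr p) * (ennreal (d powr p) + ennreal (excess (- real M) (real M) y powr p)) \<partial>\<rho>)"
  proof (rule nn_integral_mono)
    fix y
    have "(d + excess a (a + d * real K) y) powr p \<le> 2 powr p * (d powr p + excess a (a + d * real K) y powr p)"
      using d p by (intro powr_add_le) auto
    then have "ennreal ((d + excess a (a + d * real K) y) powr p)
      \<le> ennreal (2 powr p * (d powr p + excess a (a + d * real K) y powr p))" by (rule ennreal_leI)
    then show "ennreal ((d + excess a (a + d * real K) y) powr p)
      \<le> ennreal (2 powr p) * (ennreal (d powr p) + ennreal (excess (- real M) (real M) y powr p))"
      unfolding b by (simp add: ennreal_mult a_def)
  qed
  also have "\<dots> = ennreal (2 powr p) * (ennreal (d powr p) + tail M)"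
    using emeasure_space_1 by (simp add: nn_integral_cmult nn_integral_add tail_def)
  also have "\<dots> \<le> ennreal (2 powr p) * (ennreal (e / (2 * 2 powr p)) + ennreal (e / (2 * 2 powr p)))"
    using d(2) M(2) by (intro mult_left_mono add_mono ennreal_leI) auto
  also have "\<dots> = ennreal e"
    using e by (simp add: ennreal_plus[symmetric] ennreal_mult[symmetric] del: ennreal_plus)
  finally have cost: "(\<integral>\<^sup>+y. ennreal ((d + excess a (a + d * real K) y) powr p) \<partial>\<rho>) \<le> ennreal e" .
  have "ennreal (\<Sum>k<K. d * H ((level \<rho> a d K (Suc k) - level \<rho> a d K k) / d)) \<le> energy p UNIV H \<rho> + ennreal e"
  proof (cases "energy p UNIV H \<rho> < \<infinity>")
    case True
    obtain g where g: "g \<in> borel_measurable borel" "\<And>x. 0 \<le> g x" "\<rho> = density lborel (\<lambda>x. ennreal (g x))"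
      and E: "energy p UNIV H \<rho> = (\<integral>\<^sup>+x\<in>UNIV. ennreal (H (g x)) \<partial>lborel)"
      by (rule energy_finite_density[OF True]) (rule that)
    let ?t = "\<lambda>k. d * H ((level \<rho> a d K (Suc k) - level \<rho> a d K k) / d)"
    have split: "{..<K} = insert 0 (insert (K - 1) {1..<K - 1})" using K by auto
    have "(\<Sum>k<K. ?t k) = ?t 0 + (?t (K - 1) + (\<Sum>k\<in>{1..<K - 1}. ?t k))"
      unfolding split using K by (subst sum.insert; simp)+
    also have "?t 0 \<le> e / 2"
      using M(3) K by (simp add: level_def a_def)
    also have "?t (K - 1) \<le> e / 2"
    proof -
      have "a + d * real (K - 1) = real M - d" using b K by (simp add: of_nat_diff algebra_simps)
      moreover have "\<not> K \<le> K - Suc 0" using K by simp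
      ultimately show ?thesis using M(4) K by (simp add: level_def)
    qed
    also have "(\<Sum>k\<in>{1..<K - 1}. ?t k) = (\<Sum>k\<in>{1..<K - 1}. d * H (measure \<rho> (grid_cell a d k) / d))"
      using d(1) by (intro sum.cong) (auto simp: level_def cdf_diff_eq)
    finally have "ennreal (\<Sum>k<K. ?t k) \<le> ennreal (e + (\<Sum>k\<in>{1..<K - 1}. d * H (measure \<rho> (grid_cell a d k) / d)))"
      by (intro ennreal_leI) simp
    also have "\<dots> = ennreal e + ennreal (\<Sum>k\<in>{1..<K - 1}. d * H (measure \<rho> (grid_cell a d k) / d))"
      using e d(1) nonneg by (intro ennreal_plus sum_nonneg mult_nonneg_nonneg) auto
    also have "\<dots> \<le> ennreal e + energy p UNIV H \<rho>"
      unfolding E by (intro add_left_mono sum_cells_le_energy[OF g prob_space_axioms d(1)]) auto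
    finally show ?thesis by (simp add: add.commute)
  qed (simp add: not_less top_unique)
  then show ?thesis using that[OF d(1) _ cost] K by simp
qed

lemma eventually_recovery:
  assumes P: "\<rho> \<in> P_p p \<Omega>" and p: "0 < p" and e: "0 < e"
    and \<Omega>: "\<Omega> = UNIV \<or> (\<exists>a b. a < b \<and> \<Omega> = {a..b})"
  shows "\<forall>\<^sub>F N in sequentially. \<exists>xs. (length xs = N \<and> sorted_wrt (<) xs \<and> set xs \<subseteq> \<Omega>) \<and>
    transport_cost p (empirical xs) \<rho> \<le> ennreal e \<and>
    ennreal (discrete_energy N H (empirical xs)) \<le> energy p \<Omega> H \<rho> + ennreal e"
proof -
  have e2: "0 < e / 2" using e by simp
  have \<rho>: "real_distribution \<rho>" by (rule P_p_real_distribution[OF P])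
  obtain a d K where d: "0 < d" and K: "0 < K" and sub: "{a..a + d * real K} \<subseteq> \<Omega>"
    and cost: "(\<integral>\<^sup>+y. ennreal ((d + excess a (a + d * real K) y) powr p) \<partial>\<rho>) \<le> ennreal (e / 2)"
    and en: "ennreal (\<Sum>k<K. d * H ((level \<rho> a d K (Suc k) - level \<rho> a d K k) / d)) \<le> energy p \<Omega> H \<rho> + ennreal (e / 2)"
    using \<Omega>
  proof (elim disjE exE conjE)
    assume U: "\<Omega> = UNIV"
    show thesis by (rule grid_choice_line[OF P[unfolded U] p e2]) (use that U in auto)
  next
    fix a b assume ab: "a < b" and U: "\<Omega> = {a..b}"
    show thesis by (rule grid_choice_interval[OF P[unfolded U] ab p e2]) (use that U in auto)
  qed
  have fin: "(\<integral>\<^sup>+y. ennreal ((d * real K + excess a (a + d * real K) y) powr p) \<partial>\<rho>) < \<infinity>"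
    by (rule P_p_integral_finite[OF P, where c = "d * real K + \<bar>a\<bar> + \<bar>a + d * real K\<bar>"])
      (use p d in \<open>auto simp: excess_def\<close>)
  from eventually_transport_cost_grid_le[OF \<rho> d K p fin e2] eventually_discrete_energy_grid_le[OF \<rho> d K e2, of a]
  show ?thesis
  proof eventually_elim
    case (elim N)
    let ?xs = "grid_particles a d (level_index \<rho> a d K N) N"
    note valid = grid_particles_valid[OF d level_index_props[OF \<rho> d K, of a N], of a]
    have "transport_cost p (empirical ?xs) \<rho> \<le> ennreal (e / 2) + ennreal (e / 2)"
      using elim(1) cost by (meson add_right_mono order_trans)
    also have "\<dots> = ennreal e" using e by (simp add: ennreal_plus[symmetric] del: ennreal_plus)
    finally have 1: "transport_cost p (empirical ?xs) \<rho> \<le> ennreal e" .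
    have "ennreal (discrete_energy N H (empirical ?xs))
      \<le> ennreal ((\<Sum>k<K. d * H ((level \<rho> a d K (Suc k) - level \<rho> a d K k) / d)) + e / 2)"
      by (rule ennreal_leI) (rule elim(2))
    also have "\<dots> = ennreal (\<Sum>k<K. d * H ((level \<rho> a d K (Suc k) - level \<rho> a d K k) / d)) + ennreal (e / 2)"
      using e d nonneg monoD[OF level_mono[OF \<rho> d K], of _ "Suc _" a]
      by (intro ennreal_plus sum_nonneg mult_nonneg_nonneg nonneg divide_nonneg_nonneg) auto
    also have "\<dots> \<le> energy p \<Omega> H \<rho> + ennreal (e / 2) + ennreal (e / 2)"
      by (rule add_right_mono) (rule en)
    also have "\<dots> = energy p \<Omega> H \<rho> + ennreal e"
      using e by (simp add: add.assoc ennreal_plus[symmetric] del: ennreal_plus)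
    finally have 2: "ennreal (discrete_energy N H (empirical ?xs)) \<le> energy p \<Omega> H \<rho> + ennreal e" .
    show ?case using valid sub 1 2 by (intro exI[of _ ?xs]) auto
  qed
qed

end

section \<open>Diagonal sequence and Gamma-convergence\<close>

text \<open>For each \<open>N\<close> the smallest tolerance \<open>1 / (j + 1)\<close> with \<open>j \<le> N\<close> that can be met is used; the bound
\<open>j \<le> N\<close> only guarantees that there is a smallest one.\<close>

lemma diagonal_sequence:
  fixes Q :: "real \<Rightarrow> nat \<Rightarrow> 'x \<Rightarrow> bool"
  assumes ex: "\<And>N. N0 \<le> N \<Longrightarrow> \<exists>x. V N x"
    and ev: "\<And>e. 0 < e \<Longrightarrow> \<forall>\<^sub>F N in sequentially. \<exists>x. V N x \<and> Q e N x"
    and mono: "\<And>e e' N x. 0 < e \<Longrightarrow> e \<le> e' \<Longrightarrow> Q e N x \<Longrightarrow> Q e' N x"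
  obtains x where "\<And>N. N0 \<le> N \<Longrightarrow> V N (x N)" "\<And>e. 0 < e \<Longrightarrow> \<forall>\<^sub>F N in sequentially. Q e N (x N)"
proof -
  define J where "J N = {j. j \<le> N \<and> (\<exists>x. V N x \<and> Q (1 / real (Suc j)) N x)}" for N
  have fin: "finite (J N)" for N by (rule finite_subset[of _ "{..N}"]) (auto simp: J_def)
  have "\<exists>x. (N0 \<le> N \<longrightarrow> V N x) \<and> (J N \<noteq> {} \<longrightarrow> Q (1 / real (Suc (Max (J N)))) N x)" for N
  proof (cases "J N = {}")
    case False
    then have "Max (J N) \<in> J N" by (rule Max_in[OF fin])
    then show ?thesis by (auto simp: J_def)
  qed (use ex in blast)
  then obtain x where x: "\<And>N. N0 \<le> N \<Longrightarrow> V N (x N)"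
    "\<And>N. J N \<noteq> {} \<Longrightarrow> Q (1 / real (Suc (Max (J N)))) N (x N)" by metis
  have "\<forall>\<^sub>F N in sequentially. Q e N (x N)" if e: "0 < e" for e
  proof -
    obtain j where j: "1 / real (Suc j) < e" using nat_approx_posE[OF e] by auto
    have "\<forall>\<^sub>F N in sequentially. \<exists>x. V N x \<and> Q (1 / real (Suc j)) N x" by (rule ev) simp
    then show ?thesis using eventually_ge_at_top[of j]
    proof eventually_elim
      case (elim N)
      then have "j \<in> J N" by (auto simp: J_def)
      then have "j \<le> Max (J N)" "J N \<noteq> {}" using fin by auto
      then have "1 / real (Suc (Max (J N))) \<le> 1 / real (Suc j)" by (intro divide_left_mono) auto
      then show ?case using mono[OF _ _ x(2)[OF \<open>J N \<noteq> {}\<close>], of e] j by simp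
    qed
  qed
  with x(1) show ?thesis by (rule that)
qed

lemma tendsto_zero_ennreal_iff:
  fixes f :: "'a \<Rightarrow> ennreal"
  shows "(f \<longlongrightarrow> 0) F \<longleftrightarrow> (\<forall>e>0. \<forall>\<^sub>F x in F. f x < ennreal e)"
proof
  assume R: "\<forall>e>0. \<forall>\<^sub>F x in F. f x < ennreal e"
  show "(f \<longlongrightarrow> 0) F"
  proof (rule order_tendstoI)
    fix y :: ennreal assume "0 < y"
    then obtain z where z: "0 < z" "z < y" using dense by blast
    then have "z < top" using order.strict_trans2[of z y top] by simp
    then obtain e where e: "z = ennreal e" "0 \<le> e" by (cases z) auto
    then have "\<forall>\<^sub>F x in F. f x < ennreal e" using R z by auto
    then show "\<forall>\<^sub>F x in F. f x < y" by eventually_elim (use e z in auto)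
  qed simp
qed (auto intro: order_tendstoD)

lemma wasserstein_less_iff:
  assumes "0 < p" "0 < e"
  shows "wasserstein p \<mu> \<nu> < ennreal e \<longleftrightarrow> transport_cost p \<mu> \<nu> < ennreal (e powr p)"
proof (cases "transport_cost p \<mu> \<nu>")
  case (real c)
  have "c powr (1 / p) < e \<longleftrightarrow> c < e powr p"
  proof
    assume "c powr (1 / p) < e"
    then have "(c powr (1 / p)) powr p < e powr p" using assms by (intro powr_less_mono2) auto
    then show "c < e powr p" using real assms by (simp add: powr_powr)
  next
    assume "c < e powr p"
    then have "c powr (1 / p) < (e powr p) powr (1 / p)" using real assms by (intro powr_less_mono2) auto
    then show "c powr (1 / p) < e" using assms by (simp add: powr_powr)
  qed
  then show ?thesis using real assms by (simp add: wasserstein_def ennreal_less_iff)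
qed (simp add: wasserstein_def)

lemma wasserstein_tendsto_zero_iff:
  assumes p: "0 < p"
  shows "((\<lambda>N. wasserstein p (\<mu> N) \<nu>) \<longlongrightarrow> 0) F \<longleftrightarrow> ((\<lambda>N. transport_cost p (\<mu> N) \<nu>) \<longlongrightarrow> 0) F"
proof -
  have "(\<forall>e>0. \<forall>\<^sub>F N in F. transport_cost p (\<mu> N) \<nu> < ennreal (e powr p))
    \<longleftrightarrow> (\<forall>e>0. \<forall>\<^sub>F N in F. transport_cost p (\<mu> N) \<nu> < ennreal e)" (is "?L \<longleftrightarrow> ?R")
  proof
    assume L: ?L
    show ?R
    proof (intro allI impI)
      fix e :: real assume e: "0 < e"
      then have "\<forall>\<^sub>F N in F. transport_cost p (\<mu> N) \<nu> < ennreal ((e powr (1 / p)) powr p)"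
        using L by simp
      then show "\<forall>\<^sub>F N in F. transport_cost p (\<mu> N) \<nu> < ennreal e"
        using p e by (simp add: powr_powr)
    qed
  qed simp
  then show ?thesis
    unfolding tendsto_zero_ennreal_iff by (simp add: wasserstein_less_iff[OF p])
qed

lemma hypothesis_A_internal_energy: "hypothesis_A H \<Longrightarrow> internal_energy H"
  by (auto simp: hypothesis_A_def internal_energy_def)

lemma exists_particles:
  assumes \<Omega>: "\<Omega> = UNIV \<or> (\<exists>a b. a < b \<and> \<Omega> = {a..b})"
  shows "\<exists>xs. length xs = N \<and> sorted_wrt (<) xs \<and> set xs \<subseteq> (\<Omega> :: real set)"
proof -
  obtain a b where ab: "a < b" "{a..b} \<subseteq> \<Omega>" using \<Omega> zero_less_one by auto
  define C where "C k = (if k = 0 then 0 else N)" for k :: nat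
  have "mono C" by (auto simp: C_def mono_def)
  from grid_particles_valid[of "b - a" C 1 N a] this ab show ?thesis
    by (intro exI[of _ "grid_particles a (b - a) C N"]) (auto simp: C_def)
qed

theorem theorem5:
  fixes p :: real and \<Omega> :: "real set" and H f\<^sub>1 f\<^sub>2 :: "real \<Rightarrow> real"
  assumes p: "1 < p"
    and \<Omega>: "\<Omega> = UNIV \<or> (\<exists>a b. a < b \<and> \<Omega> = {a..b})"
    and H: "hypothesis_A H"
    and f\<^sub>1: "continuous_on {0..} f\<^sub>1" "f\<^sub>1 1 = 1"
    and f\<^sub>2: "continuous_on {0..} f\<^sub>2" "f\<^sub>2 1 = 0"
    and scaling: "\<And>x \<alpha>. 0 \<le> x \<Longrightarrow> 0 \<le> \<alpha> \<Longrightarrow> H (\<alpha> * x) \<le> f\<^sub>1 \<alpha> * H x + f\<^sub>2 \<alpha> * x"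
  shows "\<forall>\<rho> \<in> P_p p \<Omega>.
      (\<forall>\<mu> :: nat \<Rightarrow> real measure.
         (\<forall>N\<ge>2. \<mu> N \<in> A_N N \<Omega>) \<and> (\<lambda>N. wasserstein p (\<mu> N) \<rho>) \<longlonglongrightarrow> 0 \<longrightarrow>
         energy p \<Omega> H \<rho> \<le> liminf (\<lambda>N. ennreal (discrete_energy N H (\<mu> N)))) \<and>
      (\<exists>\<mu> :: nat \<Rightarrow> real measure.
         (\<forall>N\<ge>2. \<mu> N \<in> A_N N \<Omega>) \<and> (\<lambda>N. wasserstein p (\<mu> N) \<rho>) \<longlonglongrightarrow> 0 \<and>
         limsup (\<lambda>N. ennreal (discrete_energy N H (\<mu> N))) \<le> energy p \<Omega> H \<rho>)"
proof (intro ballI conjI allI impI)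
  interpret internal_energy H by (rule hypothesis_A_internal_energy[OF H])
  have p0: "0 < p" "0 \<le> p" using p by auto
  fix \<rho> assume \<rho>: "\<rho> \<in> P_p p \<Omega>"
  then have prob: "prob_space \<rho>" "sets \<rho> = sets borel" by (auto simp: P_p_def)
  {
    fix \<mu> :: "nat \<Rightarrow> real measure"
    assume \<mu>: "(\<forall>N\<ge>2. \<mu> N \<in> A_N N \<Omega>) \<and> (\<lambda>N. wasserstein p (\<mu> N) \<rho>) \<longlonglongrightarrow> 0"
    have "\<exists>xs. 2 \<le> N \<longrightarrow> length xs = N \<and> sorted_wrt (<) xs \<and> empirical xs = \<mu> N" for N
      using \<mu> by (cases "2 \<le> N") (fastforce simp: A_N_def)+
    then obtain xs where xs: "\<And>N. 2 \<le> N \<Longrightarrow> length (xs N) = N"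
      "\<And>N. 2 \<le> N \<Longrightarrow> sorted_wrt (<) (xs N)" "\<And>N. 2 \<le> N \<Longrightarrow> empirical (xs N) = \<mu> N"
      by metis
    have eq: "\<forall>\<^sub>F N in sequentially. empirical (xs N) = \<mu> N"
      using eventually_ge_at_top[of 2] by eventually_elim (rule xs(3))
    have "(\<lambda>N. transport_cost p (\<mu> N) \<rho>) \<longlonglongrightarrow> 0"
      using \<mu> wasserstein_tendsto_zero_iff[OF p0(1)] by blast
    then have cost: "(\<lambda>N. transport_cost p (empirical (xs N)) \<rho>) \<longlonglongrightarrow> 0"
      by (rule Lim_transform_eventually) (use eq in \<open>auto elim: eventually_mono\<close>)
    have "energy p \<Omega> H \<rho> \<le> liminf (\<lambda>N. ennreal (discrete_energy N H (empirical (xs N))))"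
      by (rule energy_le_liminf[OF xs(1,2) cost p0(2) prob refl \<rho>]) (use \<Omega> in auto)
    also have "\<dots> = liminf (\<lambda>N. ennreal (discrete_energy N H (\<mu> N)))"
      by (rule Liminf_eq) (use eq in \<open>auto elim: eventually_mono\<close>)
    finally show "energy p \<Omega> H \<rho> \<le> liminf (\<lambda>N. ennreal (discrete_energy N H (\<mu> N)))" .
  }
  obtain xs where valid: "\<And>N. 2 \<le> N \<Longrightarrow> length (xs N) = N \<and> sorted_wrt (<) (xs N) \<and> set (xs N) \<subseteq> \<Omega>"
    and ev: "\<And>e. 0 < e \<Longrightarrow> \<forall>\<^sub>F N in sequentially. transport_cost p (empirical (xs N)) \<rho> \<le> ennreal e \<and>
      ennreal (discrete_energy N H (empirical (xs N))) \<le> energy p \<Omega> H \<rho> + ennreal e"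
  proof (rule diagonal_sequence[where V = "\<lambda>N xs. length xs = N \<and> sorted_wrt (<) xs \<and> set xs \<subseteq> \<Omega>"
        and Q = "\<lambda>e N xs. transport_cost p (empirical xs) \<rho> \<le> ennreal e \<and>
          ennreal (discrete_energy N H (empirical xs)) \<le> energy p \<Omega> H \<rho> + ennreal e" and ?N0.0 = 2])
    fix e e' :: real and N :: nat and xs :: "real list"
    assume "e \<le> e'" and Q: "transport_cost p (empirical xs) \<rho> \<le> ennreal e \<and>
      ennreal (discrete_energy N H (empirical xs)) \<le> energy p \<Omega> H \<rho> + ennreal e"
    then have "ennreal e \<le> ennreal e'" by (intro ennreal_leI)
    then show "transport_cost p (empirical xs) \<rho> \<le> ennreal e' \<and>
      ennreal (discrete_energy N H (empirical xs)) \<le> energy p \<Omega> H \<rho> + ennreal e'"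
      using Q by (meson add_left_mono order_trans)
  qed (use exists_particles[OF \<Omega>] eventually_recovery[OF \<rho> p0(1) _ \<Omega>] that in blast)+
  have cost: "(\<lambda>N. transport_cost p (empirical (xs N)) \<rho>) \<longlonglongrightarrow> 0"
    unfolding tendsto_zero_ennreal_iff
  proof (intro allI impI)
    fix e :: real assume e: "0 < e"
    then have "\<forall>\<^sub>F N in sequentially. transport_cost p (empirical (xs N)) \<rho> \<le> ennreal (e / 2)"
      using ev[of "e / 2"] by (auto elim: eventually_mono)
    moreover have "ennreal (e / 2) < ennreal e" using e by (simp add: ennreal_less_iff)
    ultimately show "\<forall>\<^sub>F N in sequentially. transport_cost p (empirical (xs N)) \<rho> < ennreal e"
      by (auto elim: eventually_mono intro: le_less_trans)
  qed
  have "limsup (\<lambda>N. ennreal (discrete_energy N H (empirical (xs N)))) \<le> energy p \<Omega> H \<rho>"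
  proof (rule ennreal_le_epsilon)
    fix e :: real assume "0 < e"
    then show "limsup (\<lambda>N. ennreal (discrete_energy N H (empirical (xs N)))) \<le> energy p \<Omega> H \<rho> + ennreal e"
      using ev[of e] by (intro Limsup_bounded) (auto elim: eventually_mono)
  qed
  then show "\<exists>\<mu> :: nat \<Rightarrow> real measure.
         (\<forall>N\<ge>2. \<mu> N \<in> A_N N \<Omega>) \<and> (\<lambda>N. wasserstein p (\<mu> N) \<rho>) \<longlonglongrightarrow> 0 \<and>
         limsup (\<lambda>N. ennreal (discrete_energy N H (\<mu> N))) \<le> energy p \<Omega> H \<rho>"
    using valid cost wasserstein_tendsto_zero_iff[OF p0(1), of "\<lambda>N. empirical (xs N)" \<rho>]
    by (intro exI[of _ "\<lambda>N. empirical (xs N)"]) (auto simp: A_N_def)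
qed

end
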